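(* Let $N\geq 3$, let $\Omega\subset\mathbb{R}^N$ be an open set and let $\psi:\Omega\to\mathbb{R}$ be a smooth function such that $u=\nabla\psi$ satisfies the kinetic formulation $$v\cdot\nabla_x\chi(\cdot,\xi)=0\quad\text{distributionally in }\Omega,\ \text{ for every }\xi\in\mathbb{S}^{N-1}\text{ and every }v\in\xi^\perp .$$ Assume that $|u|$ never vanishes on a level set $\{x\in\Omega:\psi(x)=\alpha\}$ for some $\alpha\in\mathbb{R}$, and let $\mathcal{S}$ be a connected component of $\{\psi=\alpha\}$. Then $\mathcal{S}$ is locally a totally umbilical hypersurface, that is, either a piece of an $(N-1)$-sphere or a piece of a hyperplane.
   Context: For $\xi\in\mathbb{S}^{N-1}$ (the unit sphere of $\mathbb{R}^N$), $\xi^\perp=\{v\in\mathbb{R}^N: v\cdot\xi=0\}$, and $\chi(\cdot,\xi):\Omega\to\{0,1\}$ is defined from $u$ by $\chi(x,\xi)=1$ if $u(x)\cdot\xi>0$ and $\chi(x,\xi)=0$ if $u(x)\cdot\xi\leq 0$. Note that no constraint on the norm of $u$ is imposed. A hypersurface is totally umbilical if at each of its points the differential of the Gauss map (unit normal) is a scalar multiple of the identity on the tangent space. *)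

theory Defs
  imports "HOL-Analysis.Analysis"
begin

text \<open>On open sets this is \<open>C\<^sup>k\<close>: iterated directional derivatives of a Frechet
  differentiable function, the last ones continuous.\<close>

fun Ck_on :: "nat \<Rightarrow> 'a::euclidean_space set \<Rightarrow> ('a \<Rightarrow> 'b::real_normed_vector) \<Rightarrow> bool" where
  "Ck_on 0 S f \<longleftrightarrow> continuous_on S f"
| "Ck_on (Suc k) S f \<longleftrightarrow> (\<forall>x\<in>S. f differentiable (at x)) \<and>
     (\<forall>v. Ck_on k S (\<lambda>x. frechet_derivative f (at x) v))"

definition smooth_on :: "'a::euclidean_space set \<Rightarrow> ('a \<Rightarrow> 'b::real_normed_vector) \<Rightarrow> bool" where
  "smooth_on S f \<longleftrightarrow> (\<forall>k. Ck_on k S f)"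

definition test_function :: "'a::euclidean_space set \<Rightarrow> ('a \<Rightarrow> real) \<Rightarrow> bool" where
  "test_function \<Omega> \<phi> \<longleftrightarrow> smooth_on UNIV \<phi> \<and>
     compact (closure {x. \<phi> x \<noteq> 0}) \<and> closure {x. \<phi> x \<noteq> 0} \<subseteq> \<Omega>"

text \<open>\<open>v \<cdot> \<nabla>f = 0\<close> in \<open>\<D>'(\<Omega>)\<close>, intended for locally integrable \<open>f\<close>; the Frechet derivative
  of \<open>\<phi>\<close> applied to \<open>v\<close> is \<open>v \<cdot> \<nabla>\<phi>\<close>.\<close>

definition distr_dir_deriv_zero ::
    "'a::euclidean_space set \<Rightarrow> ('a \<Rightarrow> real) \<Rightarrow> 'a \<Rightarrow> bool" where
  "distr_dir_deriv_zero \<Omega> f v \<longleftrightarrow>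
     (\<forall>\<phi>. test_function \<Omega> \<phi> \<longrightarrow>
        (LINT x:\<Omega>|lebesgue. f x * frechet_derivative \<phi> (at x) v) = 0)"

definition kinetic_chi :: "('a::real_inner \<Rightarrow> 'a) \<Rightarrow> 'a \<Rightarrow> 'a \<Rightarrow> real" where
  "kinetic_chi u x \<xi> = (if u x \<bullet> \<xi> > 0 then 1 else 0)"

definition kinetic_formulation :: "'a::euclidean_space set \<Rightarrow> ('a \<Rightarrow> 'a) \<Rightarrow> bool" where
  "kinetic_formulation \<Omega> u \<longleftrightarrow>
     (\<forall>\<xi>\<in>sphere 0 1. \<forall>v. v \<bullet> \<xi> = 0 \<longrightarrow> distr_dir_deriv_zero \<Omega> (\<lambda>x. kinetic_chi u x \<xi>) v)"

definition smooth_hypersurface :: "'a::euclidean_space set \<Rightarrow> bool" where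
  "smooth_hypersurface H \<longleftrightarrow>
     (\<forall>p\<in>H. \<exists>U (g :: 'a \<Rightarrow> real). open U \<and> p \<in> U \<and> smooth_on U g \<and>
        H \<inter> U = {x \<in> U. g x = 0} \<and> (\<forall>x\<in>H \<inter> U. frechet_derivative g (at x) \<noteq> (\<lambda>_. 0)))"

definition tangent_space :: "'a::euclidean_space set \<Rightarrow> 'a \<Rightarrow> 'a set" where
  "tangent_space H p =
     {v. \<exists>\<gamma> \<epsilon>. 0 < \<epsilon> \<and> smooth_on {-\<epsilon><..<\<epsilon>} \<gamma> \<and> \<gamma> ` {-\<epsilon><..<\<epsilon>} \<subseteq> H \<and>
        \<gamma> (0::real) = p \<and> (\<gamma> has_vector_derivative v) (at 0)}"

definition gauss_map :: "'a::euclidean_space set \<Rightarrow> ('a \<Rightarrow> 'a) \<Rightarrow> bool" where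
  "gauss_map H n \<longleftrightarrow> continuous_on H n \<and>
     (\<forall>x\<in>H. norm (n x) = 1 \<and> (\<forall>v\<in>tangent_space H x. n x \<bullet> v = 0))"

text \<open>A derivative within \<open>H\<close> at \<open>p\<close> is determined only on the tangent space at \<open>p\<close>, where it is
  the differential of the Gauss map.\<close>

definition totally_umbilical :: "'a::euclidean_space set \<Rightarrow> bool" where
  "totally_umbilical H \<longleftrightarrow> smooth_hypersurface H \<and>
     (\<exists>n. gauss_map H n \<and>
        (\<forall>p\<in>H. \<exists>D \<mu>. (n has_derivative D) (at p within H) \<and>
           (\<forall>v\<in>tangent_space H p. D v = \<mu> *\<^sub>R v)))"

definition piece_of_sphere :: "'a::euclidean_space set \<Rightarrow> bool" where
  "piece_of_sphere S \<longleftrightarrow> (\<exists>c r. 0 < r \<and> openin (top_of_set (sphere c r)) S)"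

definition piece_of_hyperplane :: "'a::euclidean_space set \<Rightarrow> bool" where
  "piece_of_hyperplane S \<longleftrightarrow> (\<exists>a b. a \<noteq> 0 \<and> openin (top_of_set {x. a \<bullet> x = b}) S)"

end

theory Submission
  imports Defs
begin

text \<open>
  The jump set of \<open>\<chi>(\<cdot>, \<xi>)\<close> can only be crossed in directions that are not orthogonal to \<open>\<xi>\<close>: if
  \<open>y - x\<close> is orthogonal to \<open>\<xi>\<close>, the segment from \<open>x\<close> to \<open>y\<close> lies in \<open>\<Omega>\<close> and \<open>u x \<bullet> \<xi> > 0\<close>, then
  \<open>u y \<bullet> \<xi> \<ge> 0\<close> (\<open>kinetic_sign_transport\<close>). This is obtained by testing the kinetic formulation
  against a smooth tube around the segment, whose derivative along \<open>y - x\<close> is a bump at \<open>x\<close> minus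
  a bump at \<open>y\<close>. Letting \<open>\<xi>\<close> vary in the orthogonal complement of \<open>y - x\<close> shows that \<open>u x\<close>,
  \<open>u y\<close> and \<open>y - x\<close> are linearly dependent (\<open>kinetic_coplanar\<close>). In other words, the lines
  \<open>x + \<real> u x\<close> are pairwise coplanar.

  Pairwise coplanar lines that are not all in one plane are concurrent or parallel, and in dimension
  at least three the lines through the points of an open set are not all in one plane. Hence near each
  point of the level set there is \<open>(a, b) \<noteq> 0\<close> with \<open>b + a x\<close> parallel to \<open>u x\<close>, and two distinct
  lines determine the pencil, so that \<open>(a, b)\<close> propagates along the connected set \<open>S\<close>
  (\<open>in_pencil_propagates\<close>, \<open>kinetic_pencil\<close>).

  The field \<open>b + a x\<close> is half the gradient of \<open>2 b \<bullet> x + a x \<bullet> x\<close>, whose level sets are spheres or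
  hyperplanes. As the gradient \<open>u\<close> of \<open>\<psi>\<close> is parallel to it, \<open>\<psi>\<close> is constant along curves in these
  level sets and injective along the lines
  of the pencil, so the level sets of both functions agree locally
  (\<open>pencil_gradient_level_set\<close>). Thus \<open>S\<close> is open in one sphere or one hyperplane, where the unit
  normal is the restriction of an affine map with scalar linear part.
\<close>

section \<open>Closure properties of smooth functions\<close>

lemma Ck_on_Suc_I:
  assumes "\<And>x. (f has_derivative f' x) (at x)" "\<And>v. Ck_on k UNIV (\<lambda>x. f' x v)"
  shows "Ck_on (Suc k) UNIV f"
proof -
  have "frechet_derivative f (at x) = f' x" for x
    using frechet_derivative_at[OF assms(1)] by simp
  then show ?thesis
    using assms by (auto simp: differentiable_def)
qed

lemma Ck_on_Suc_D:
  assumes "Ck_on (Suc k) UNIV f"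
  shows "(f has_derivative frechet_derivative f (at x)) (at x)"
    and "Ck_on k UNIV (\<lambda>x. frechet_derivative f (at x) v)"
  using assms by (auto simp: frechet_derivative_works)

lemma Ck_on_mono: "Ck_on k T f \<Longrightarrow> S \<subseteq> T \<Longrightarrow> Ck_on k S f"
  by (induction k arbitrary: f) (auto intro: continuous_on_subset)

lemma Ck_on_pred: "Ck_on (Suc k) UNIV f \<Longrightarrow> Ck_on k UNIV f"
proof (induction k arbitrary: f)
  case 0
  then show ?case
    by (auto intro!: differentiable_imp_continuous_on simp: differentiable_on_def)
next
  case (Suc k)
  show ?case
    by (rule Ck_on_Suc_I[OF Ck_on_Suc_D(1)[OF Suc.prems]])
       (use Suc.IH Ck_on_Suc_D(2)[OF Suc.prems] in blast)
qed

lemma Ck_on_const: "Ck_on k UNIV (\<lambda>x. c)"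
proof (induction k arbitrary: c)
  case (Suc k)
  show ?case by (rule Ck_on_Suc_I[where f' = "\<lambda>x v. 0"]) (auto simp: Suc)
qed simp

lemma Ck_on_bounded_linear: "bounded_linear f \<Longrightarrow> Ck_on k UNIV f"
proof (cases k)
  case 0
  then show "bounded_linear f \<Longrightarrow> ?thesis" by (simp add: linear_continuous_on)
next
  case (Suc j)
  show "bounded_linear f \<Longrightarrow> ?thesis"
    unfolding Suc by (rule Ck_on_Suc_I[OF bounded_linear_imp_has_derivative]) (auto simp: Ck_on_const)
qed

lemma Ck_on_add: "Ck_on k UNIV f \<Longrightarrow> Ck_on k UNIV g \<Longrightarrow> Ck_on k UNIV (\<lambda>x. f x + g x)"
proof (induction k arbitrary: f g)
  case 0
  then show ?case by (simp add: continuous_on_add)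
next
  case (Suc k)
  show ?case
    by (rule Ck_on_Suc_I[OF has_derivative_add])
       (use Suc Ck_on_Suc_D in blast)+
qed

lemma Ck_on_mult:
  fixes f g :: "'a::euclidean_space \<Rightarrow> real"
  shows "Ck_on k UNIV f \<Longrightarrow> Ck_on k UNIV g \<Longrightarrow> Ck_on k UNIV (\<lambda>x. f x * g x)"
proof (induction k arbitrary: f g)
  case 0
  then show ?case by (simp add: continuous_on_mult)
next
  case (Suc k)
  note f = Ck_on_Suc_D[OF Suc.prems(1)] and g = Ck_on_Suc_D[OF Suc.prems(2)]
  show ?case
    by (rule Ck_on_Suc_I[OF has_derivative_mult[OF f(1) g(1)]])
       (intro Ck_on_add Suc.IH f(2) g(2) Suc.prems[THEN Ck_on_pred])
qed

lemma Ck_on_compose: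
  fixes h :: "real \<Rightarrow> real" and f :: "'a::euclidean_space \<Rightarrow> real"
  shows "Ck_on k UNIV h \<Longrightarrow> Ck_on k UNIV f \<Longrightarrow> Ck_on k UNIV (\<lambda>x. h (f x))"
proof (induction k arbitrary: h)
  case 0
  then show ?case
    by (auto intro: continuous_on_compose2)
next
  case (Suc k)
  note h = Ck_on_Suc_D[OF Suc.prems(1)] and f = Ck_on_Suc_D[OF Suc.prems(2)]
  have scale: "frechet_derivative h (at y) s = frechet_derivative h (at y) 1 * s" for y s
    using linear_cmul[OF has_derivative_linear[OF h(1)], of y s 1] by (simp add: mult.commute)
  have der: "((\<lambda>x. h (f x)) has_derivative
      (\<lambda>v. frechet_derivative h (at (f x)) 1 * frechet_derivative f (at x) v)) (at x)" for x
    using has_derivative_compose[OF f(1) h(1)] by (subst (asm) scale)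
  show ?case
    by (rule Ck_on_Suc_I[OF der])
       (rule Ck_on_mult[OF Suc.IH[OF h(2) Ck_on_pred[OF Suc.prems(2)]] f(2)])
qed

section \<open>Smooth cut-off functions\<close>

definition flat_exp :: "nat \<Rightarrow> real \<Rightarrow> real" where
  "flat_exp n s = (if s > 0 then exp (- 1 / s) / s ^ n else 0)"

lemma flat_exp_tendsto_0: "(flat_exp n \<longlongrightarrow> 0) (at 0)"
proof -
  have "((\<lambda>x::real. x ^ n / exp x) \<longlongrightarrow> 0) at_top"
    by (rule tendsto_power_div_exp_0)
  then have "((\<lambda>s::real. inverse s ^ n / exp (inverse s)) \<longlongrightarrow> 0) (at_right 0)"
    by (rule filterlim_compose[OF _ filterlim_inverse_at_top_right])
  moreover have "\<forall>\<^sub>F s in at_right 0. inverse s ^ n / exp (inverse s) = flat_exp n s"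
    by (auto simp: eventually_at_filter flat_exp_def field_simps exp_minus)
  ultimately have "(flat_exp n \<longlongrightarrow> 0) (at_right 0)"
    by (rule Lim_transform_eventually)
  moreover have "(flat_exp n \<longlongrightarrow> 0) (at_left 0)"
    by (rule Lim_transform_eventually[OF tendsto_const])
       (auto simp: eventually_at_filter flat_exp_def)
  ultimately show ?thesis
    by (simp add: filterlim_split_at)
qed

text \<open>Dividing by \<open>s\<close> raises the index, so all difference quotients at \<open>0\<close> are again of this
  form and tend to \<open>0\<close>; this makes the family closed under differentiation.\<close>

lemma flat_exp_has_derivative:
  "(flat_exp n has_derivative (\<lambda>h. h * (flat_exp (n + 2) s - real n * flat_exp (n + 1) s))) (at s)"
proof -
  consider "s < 0" | "s = 0" | "s > 0" by linarith
  then have "(flat_exp n has_field_derivative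
      flat_exp (n + 2) s - real n * flat_exp (n + 1) s) (at s)"
  proof cases
    case 1
    have "((\<lambda>s. 0) has_field_derivative 0) (at s)" by simp
    then have "(flat_exp n has_field_derivative 0) (at s)"
      by (rule has_field_derivative_transform_within_open[of _ _ _ "{..<0}"])
         (use 1 in \<open>auto simp: flat_exp_def\<close>)
    then show ?thesis using 1 by (simp add: flat_exp_def)
  next
    case 2
    have "(\<lambda>h. (flat_exp n (0 + h) - flat_exp n 0) / h) = flat_exp (n + 1)"
      by (auto simp: flat_exp_def fun_eq_iff)
    then have "(flat_exp n has_field_derivative 0) (at 0)"
      using flat_exp_tendsto_0[of "n + 1"] by (simp add: DERIV_def)
    then show ?thesis using 2 by (simp add: flat_exp_def)
  next
    case 3
    have "((\<lambda>s. exp (- 1 / s) / s ^ n) has_field_derivative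
        flat_exp (n + 2) s - real n * flat_exp (n + 1) s) (at s)"
      using 3
      apply (auto intro!: derivative_eq_intros simp: flat_exp_def power2_eq_square)
      apply (cases n; simp add: field_simps power2_eq_square)
      done
    then show ?thesis
      by (rule has_field_derivative_transform_within_open[of _ _ _ "{0<..}"])
         (use 3 in \<open>auto simp: flat_exp_def\<close>)
  qed
  then show ?thesis
    by (simp add: has_field_derivative_def mult_commute_abs mult.commute)
qed

lemma Ck_on_flat_exp: "Ck_on k UNIV (flat_exp n)"
proof (induction k arbitrary: n)
  case 0
  show ?case
    using has_derivative_continuous[OF flat_exp_has_derivative]
    by (simp add: continuous_at_imp_continuous_on)
next
  case (Suc k)
  have "Ck_on k UNIV (\<lambda>s. h * (flat_exp (n + 2) s + (- real n) * flat_exp (n + 1) s))" for h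
    by (intro Ck_on_mult Ck_on_add Ck_on_const Suc.IH)
  then show ?case
    by (intro Ck_on_Suc_I[OF flat_exp_has_derivative]) simp
qed

definition pos_ramp :: "real \<Rightarrow> real" where
  "pos_ramp = flat_exp 0"

lemma pos_ramp_nonneg: "0 \<le> pos_ramp s"
  and pos_ramp_eq_0_iff: "pos_ramp s = 0 \<longleftrightarrow> s \<le> 0"
  and Ck_on_pos_ramp: "Ck_on k UNIV pos_ramp"
  by (auto simp: pos_ramp_def flat_exp_def Ck_on_flat_exp)

text \<open>The cut-off in the direction of transport: it rises only inside \<open>(-\<delta>, \<delta>)\<close> and falls only
  inside \<open>(1 - \<delta>, 1 + \<delta>)\<close>, the descent being the translate by \<open>1\<close> of the ascent.\<close>

lemma plateau_exists:
  fixes \<delta> :: real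
  assumes "\<delta> > 0"
  obtains b \<beta> :: "real \<Rightarrow> real"
  where "\<And>k. Ck_on k UNIV b"
    and "\<And>s. (b has_real_derivative \<beta> s - \<beta> (s - 1)) (at s)"
    and "\<And>s. b s \<noteq> 0 \<Longrightarrow> - \<delta> \<le> s \<and> s \<le> 1 + \<delta>"
    and "\<And>s. 0 \<le> \<beta> s" "\<And>s. \<beta> s \<noteq> 0 \<longleftrightarrow> \<bar>s\<bar> < \<delta>"
    and "continuous_on UNIV \<beta>"
proof -
  define \<beta> where "\<beta> = (\<lambda>s. pos_ramp (\<delta> - s) * pos_ramp (\<delta> + s))"
  have lin: "Ck_on k UNIV (\<lambda>s::real. c + d * s)" for k c d
    by (intro Ck_on_add Ck_on_const Ck_on_bounded_linear bounded_linear_mult_right)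
  have Ck_\<beta>: "Ck_on k UNIV \<beta>" for k
    unfolding \<beta>_def
    using lin[of k \<delta> "-1"] lin[of k \<delta> 1]
    by (intro Ck_on_mult Ck_on_compose[OF Ck_on_pos_ramp]) auto
  have \<beta>_iff: "\<beta> s \<noteq> 0 \<longleftrightarrow> \<bar>s\<bar> < \<delta>" for s
    by (auto simp: \<beta>_def pos_ramp_eq_0_iff)
  have cont: "continuous_on UNIV \<beta>"
    using Ck_\<beta>[of 0] by simp
  have "\<exists>B. \<forall>s. -\<infinity> < ereal s \<longrightarrow> ereal s < \<infinity> \<longrightarrow> (B has_vector_derivative \<beta> s) (at s)"
    by (rule einterval_antiderivative)
       (use cont in \<open>auto simp: continuous_on_eq_continuous_at\<close>)
  then obtain B where B: "\<And>s. (B has_real_derivative \<beta> s) (at s)"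
    by (auto simp: has_real_derivative_iff_has_vector_derivative)
  define b where "b = (\<lambda>s. B s - B (s - 1))"
  have der: "(b has_real_derivative \<beta> s - \<beta> (s - 1)) (at s)" for s
    unfolding b_def using B[of s] DERIV_shift[of B "\<beta> (s - 1)" s "-1"] B[of "s - 1"]
    by (intro DERIV_diff) simp_all
  have Ck_b': "Ck_on k UNIV (\<lambda>s. \<beta> s + (-1) * \<beta> (-1 + 1 * s))" for k
    by (intro Ck_on_mult Ck_on_add Ck_on_const Ck_\<beta> Ck_on_compose[OF Ck_\<beta>] lin)
  have Ck_Suc_b: "Ck_on (Suc k) UNIV b" for k
    by (rule Ck_on_Suc_I[where f' = "\<lambda>s h. (\<beta> s - \<beta> (s - 1)) * h"])
       (use der Ck_b'[of k] in \<open>auto simp: has_field_derivative_def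
          intro!: Ck_on_mult[OF _ Ck_on_const]\<close>)
  have B_const: "B s = B t" if "s \<le> t" "\<And>r. s < r \<Longrightarrow> r < t \<Longrightarrow> \<beta> r = 0" for s t
  proof (cases "s < t")
    case True
    have "continuous_on {s..t} B"
      by (rule DERIV_continuous_on[OF has_field_derivative_at_within[OF B]])
    then show ?thesis
      using DERIV_isconst_end[of s t B] True that(2) B by metis
  qed (use that(1) in simp)
  show ?thesis
  proof
    show "Ck_on k UNIV b" for k
      using Ck_on_pred[OF Ck_Suc_b] .
    show "- \<delta> \<le> s \<and> s \<le> 1 + \<delta>" if "b s \<noteq> 0" for s
    proof (rule ccontr)
      assume "\<not> ?thesis"
      then have "B (s - 1) = B s"
        using \<beta>_iff by (intro B_const) force+
      with that show False by (simp add: b_def)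
    qed
  qed (use der \<beta>_iff cont in \<open>auto simp: \<beta>_def pos_ramp_nonneg\<close>)
qed

lemma Ck_on_norm_square: "Ck_on k UNIV (\<lambda>x::'a::euclidean_space. (x - c) \<bullet> (x - c))"
proof -
  have "Ck_on k UNIV (\<lambda>x::'a. 2 * (x \<bullet> v + (- (c \<bullet> v))))" for v
    by (intro Ck_on_mult Ck_on_add Ck_on_const Ck_on_bounded_linear bounded_linear_inner_left)
  then have "Ck_on k UNIV (\<lambda>x::'a. 2 * ((x - c) \<bullet> v))" for v
    by (simp add: inner_diff_left)
  then have "Ck_on (Suc k) UNIV (\<lambda>x::'a. (x - c) \<bullet> (x - c))"
    by (intro Ck_on_Suc_I[where f' = "\<lambda>x v. 2 * ((x - c) \<bullet> v)"])
       (auto intro!: derivative_eq_intros simp: inner_commute)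
  then show ?thesis by (rule Ck_on_pred)
qed

section \<open>Transport of the sign of \<open>u \<bullet> \<xi>\<close> along directions orthogonal to \<open>\<xi>\<close>\<close>

lemma lebesgue_integral_bump_nonzero:
  fixes g :: "'a::euclidean_space \<Rightarrow> real"
  assumes cont: "continuous_on UNIV g" and nonneg: "\<And>z. 0 \<le> g z"
    and supp: "\<And>z. g z \<noteq> 0 \<Longrightarrow> z \<in> K" and "compact K" and "g p \<noteq> 0"
  shows "(LINT z|lebesgue. g z) \<noteq> 0"
proof
  assume zero: "(LINT z|lebesgue. g z) = 0"
  have "integrable lborel (\<lambda>z. indicator K z *\<^sub>R g z)"
    using \<open>compact K\<close> cont by (intro borel_integrable_compact) (auto intro: continuous_on_subset)
  moreover have "(\<lambda>z. indicator K z *\<^sub>R g z) = g"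
    using supp by (force simp: indicator_def)
  ultimately have "integrable lebesgue g"
    using cont by (simp add: integrable_completion borel_measurable_continuous_onI)
  then have "AE z in lebesgue. g z = 0"
    using zero nonneg by (simp add: integral_nonneg_eq_0_iff_AE)
  moreover have op: "open {z. g z \<noteq> 0}"
    using cont by (intro open_Collect_neq continuous_intros)
  ultimately have "negligible {z. g z \<noteq> 0}"
    by (simp add: negligible_iff_null_sets AE_iff_null_sets borel_open)
  then show False
    using open_not_negligible[OF op] \<open>g p \<noteq> 0\<close> by auto
qed

text \<open>The test function lives on a tube around the segment and is invariant under translation along
  \<open>v = y - x\<close> apart from the plateau factor \<open>b\<close>. Its derivative along \<open>v\<close> is therefore a bump
  near \<open>x\<close> minus a bump near \<open>y\<close>; if \<open>\<chi>\<close> were \<open>1\<close> near \<open>x\<close> and \<open>0\<close> near \<open>y\<close>, only the positive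
  bump would contribute to the integral.\<close>

lemma kinetic_sign_transport:
  fixes u :: "'a::euclidean_space \<Rightarrow> 'a"
  assumes "open \<Omega>" and cont: "continuous_on \<Omega> u" and kin: "kinetic_formulation \<Omega> u"
    and seg: "closed_segment x y \<subseteq> \<Omega>" and orth: "(y - x) \<bullet> \<xi> = 0" and pos: "u x \<bullet> \<xi> > 0"
  shows "u y \<bullet> \<xi> \<ge> 0"
proof (rule ccontr)
  assume "\<not> ?thesis"
  then have neg: "u y \<bullet> \<xi> < 0" by simp
  define v where "v = y - x"
  have "v \<noteq> 0" using pos neg by (auto simp: v_def)
  then have vv: "v \<bullet> v > 0" by simp
  have xy: "x \<in> \<Omega>" "y \<in> \<Omega>" using seg by auto
  have conti: "continuous_on \<Omega> (\<lambda>z. u z \<bullet> \<xi>)"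
    using cont by (intro continuous_intros)
  have "open {z \<in> \<Omega>. u z \<bullet> \<xi> > 0}" "open {z \<in> \<Omega>. u z \<bullet> \<xi> < 0}"
    using continuous_open_preimage[OF conti \<open>open \<Omega>\<close>, of "{0<..}"]
      continuous_open_preimage[OF conti \<open>open \<Omega>\<close>, of "{..<0}"]
    by (simp_all add: vimage_def Int_def)
  then obtain r1 r2 where r1: "r1 > 0" "cball x r1 \<subseteq> {z \<in> \<Omega>. u z \<bullet> \<xi> > 0}"
    and r2: "r2 > 0" "cball y r2 \<subseteq> {z \<in> \<Omega>. u z \<bullet> \<xi> < 0}"
    using xy pos neg by (metis (mono_tags, lifting) mem_Collect_eq open_contains_cball)
  obtain r3 where r3: "r3 > 0" "(\<Union>z\<in>closed_segment x y. cball z r3) \<subseteq> \<Omega>"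
    using compact_subset_open_imp_cball_epsilon_subset[OF compact_segment \<open>open \<Omega>\<close> seg] by blast
  define r where "r = min r1 (min r2 r3)"
  have r: "r > 0" "cball x r \<subseteq> {z \<in> \<Omega>. u z \<bullet> \<xi> > 0}" "cball y r \<subseteq> {z \<in> \<Omega>. u z \<bullet> \<xi> < 0}"
    "(\<Union>z\<in>closed_segment x y. cball z r) \<subseteq> \<Omega>"
  proof -
    show "r > 0" using r1 r2 r3 by (simp add: r_def)
    have "cball x r \<subseteq> cball x r1" "cball y r \<subseteq> cball y r2" "\<And>z. cball z r \<subseteq> cball z r3"
      by (auto simp: r_def)
    then show "cball x r \<subseteq> {z \<in> \<Omega>. u z \<bullet> \<xi> > 0}" "cball y r \<subseteq> {z \<in> \<Omega>. u z \<bullet> \<xi> < 0}"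
      "(\<Union>z\<in>closed_segment x y. cball z r) \<subseteq> \<Omega>"
      using r1 r2 r3 by blast+
  qed
  \<comment> \<open>radius and longitudinal margin of the tube, chosen so that it stays within distance \<open>r\<close>\<close>
  define d \<delta> where "d = r / 2" and "\<delta> = r / (2 * norm v)"
  have d: "d > 0" "\<delta> > 0" "d + \<delta> * norm v = r"
    using \<open>r > 0\<close> \<open>v \<noteq> 0\<close> by (auto simp: d_def \<delta>_def)
  obtain b \<beta> where b: "\<And>k. Ck_on k UNIV b"
    "\<And>s. (b has_real_derivative \<beta> s - \<beta> (s - 1)) (at s)"
    "\<And>s. b s \<noteq> 0 \<Longrightarrow> - \<delta> \<le> s \<and> s \<le> 1 + \<delta>"
    and \<beta>: "\<And>s. 0 \<le> \<beta> s" "\<And>s. \<beta> s \<noteq> 0 \<longleftrightarrow> \<bar>s\<bar> < \<delta>" "continuous_on UNIV \<beta>"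
    using plateau_exists[OF \<open>\<delta> > 0\<close>] by metis
  \<comment> \<open>coordinate along \<open>v\<close>, and squared distance to the line through \<open>x\<close> and \<open>y\<close>\<close>
  define s where "s = (\<lambda>z. inverse (v \<bullet> v) * (v \<bullet> z + (- (v \<bullet> x))))"
  define w where "w = (\<lambda>z. (z - x) \<bullet> (z - x) + (- (v \<bullet> v)) * (s z * s z))"
  define a where "a = (\<lambda>z. pos_ramp (d\<^sup>2 + (-1) * w z))"
  define \<phi> where "\<phi> = (\<lambda>z. a z * b (s z))"
  have Ck_s: "Ck_on k UNIV s" for k
    unfolding s_def
    by (intro Ck_on_mult Ck_on_add Ck_on_const Ck_on_bounded_linear bounded_linear_inner_right)
  have Ck_a: "Ck_on k UNIV a" for k
    unfolding a_def w_def
    by (intro Ck_on_compose[OF Ck_on_pos_ramp] Ck_on_mult Ck_on_add Ck_on_const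
        Ck_on_norm_square Ck_s)
  have Ck_\<phi>: "Ck_on k UNIV \<phi>" for k
    unfolding \<phi>_def by (intro Ck_on_mult Ck_a Ck_on_compose[OF b(1) Ck_s])
  have s_shift: "s (z + h *\<^sub>R v) = s z + h" for z h
    using vv by (simp add: s_def algebra_simps inner_add_right)
  have w_eq: "w z = (norm (z - (x + s z *\<^sub>R v)))\<^sup>2" for z
  proof -
    have *: "v \<bullet> (z - x) = s z * (v \<bullet> v)"
      using vv by (simp add: s_def inner_diff_right)
    have "(norm (z - (x + s z *\<^sub>R v)))\<^sup>2 = ((z - x) - s z *\<^sub>R v) \<bullet> ((z - x) - s z *\<^sub>R v)"
      by (simp add: power2_norm_eq_inner algebra_simps)
    also have "\<dots> = (z - x) \<bullet> (z - x) - 2 * s z * (v \<bullet> (z - x)) + s z * s z * (v \<bullet> v)"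
      by (simp add: inner_diff_left inner_diff_right inner_commute algebra_simps)
    finally show ?thesis by (simp add: * w_def)
  qed
  have w_shift: "w (z + h *\<^sub>R v) = w z" for z h
    by (simp add: w_eq s_shift algebra_simps)
  have a_shift: "a (z + h *\<^sub>R v) = a z" for z h
    by (simp add: a_def w_shift)
  have near: "dist (x + t *\<^sub>R v) z \<le> r" if "a z \<noteq> 0" "\<bar>s z - t\<bar> \<le> \<delta>" for z t
  proof -
    have "w z < d\<^sup>2" using that(1) by (simp add: a_def pos_ramp_eq_0_iff)
    then have "norm (z - (x + s z *\<^sub>R v)) < d"
      using d(1) by (simp add: w_eq power_less_imp_less_base)
    moreover have "norm ((s z - t) *\<^sub>R v) \<le> \<delta> * norm v"
      using that(2) by (simp add: mult_right_mono)
    ultimately have "norm ((z - (x + s z *\<^sub>R v)) + (s z - t) *\<^sub>R v) \<le> r"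
      using d(3) norm_triangle_ineq[of "z - (x + s z *\<^sub>R v)" "(s z - t) *\<^sub>R v"] by linarith
    then show ?thesis
      by (simp add: dist_commute dist_norm algebra_simps)
  qed
  define T where "T = {p + q |p q. p \<in> closed_segment x y \<and> q \<in> cball 0 r}"
  have "compact T" unfolding T_def by (intro compact_sums) auto
  have "T \<subseteq> \<Omega>"
  proof
    fix z assume "z \<in> T"
    then obtain p q where "z = p + q" "p \<in> closed_segment x y" "norm q \<le> r"
      by (auto simp: T_def)
    then have "z \<in> (\<Union>z\<in>closed_segment x y. cball z r)"
      by (auto simp: dist_norm intro!: bexI[of _ p])
    then show "z \<in> \<Omega>" using r(4) by blast
  qed
  have supp: "z \<in> T" if "\<phi> z \<noteq> 0" for z
  proof -
    define t where "t = max 0 (min 1 (s z))"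
    have "- \<delta> \<le> s z" "s z \<le> 1 + \<delta>" "a z \<noteq> 0" using b(3)[of "s z"] that by (auto simp: \<phi>_def)
    then have "\<bar>s z - t\<bar> \<le> \<delta>" using \<open>\<delta> > 0\<close> by (auto simp: t_def)
    then have "dist (x + t *\<^sub>R v) z \<le> r" using near \<open>a z \<noteq> 0\<close> by blast
    moreover have "x + t *\<^sub>R v \<in> closed_segment x y"
      unfolding in_segment by (rule exI[of _ t]) (auto simp: t_def v_def algebra_simps)
    ultimately show ?thesis
      unfolding T_def
      by (intro CollectI exI[of _ "x + t *\<^sub>R v"] exI[of _ "z - (x + t *\<^sub>R v)"])
         (auto simp: dist_norm norm_minus_commute)
  qed
  have "test_function \<Omega> \<phi>"
  proof -
    have "closure {z. \<phi> z \<noteq> 0} \<subseteq> T"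
      using supp \<open>compact T\<close> by (intro closure_minimal) (auto simp: compact_imp_closed)
    moreover from this have "compact (closure {z. \<phi> z \<noteq> 0})"
      using \<open>compact T\<close> by (meson bounded_subset closed_closure compact_eq_bounded_closed)
    ultimately show ?thesis
      using \<open>T \<subseteq> \<Omega>\<close> Ck_\<phi> by (auto simp: test_function_def smooth_on_def)
  qed
  moreover have "distr_dir_deriv_zero \<Omega> (\<lambda>z. kinetic_chi u z (sgn \<xi>)) v"
  proof -
    have "\<xi> \<noteq> 0" using pos by auto
    then have "sgn \<xi> \<in> sphere 0 1" "v \<bullet> sgn \<xi> = 0"
      using orth by (simp_all add: norm_sgn v_def sgn_div_norm)
    then show ?thesis using kin by (auto simp: kinetic_formulation_def)
  qed
  ultimately have zero:
    "(LINT z:\<Omega>|lebesgue. kinetic_chi u z (sgn \<xi>) * frechet_derivative \<phi> (at z) v) = 0"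
    by (auto simp: distr_dir_deriv_zero_def)
  have chi: "kinetic_chi u z (sgn \<xi>) = (if u z \<bullet> \<xi> > 0 then 1 else 0)" for z
  proof -
    have "\<xi> \<noteq> 0" using pos by auto
    then show ?thesis by (simp add: kinetic_chi_def sgn_div_norm zero_less_mult_iff)
  qed
  \<comment> \<open>only the plateau factor varies along \<open>v\<close>\<close>
  have d\<phi>: "frechet_derivative \<phi> (at z) v = a z * (\<beta> (s z) - \<beta> (s z - 1))" for z
  proof -
    note D = Ck_on_Suc_D(1)[OF Ck_\<phi>[of "Suc 0"], of z]
    have "((\<lambda>h::real. z + h *\<^sub>R v) has_derivative (\<lambda>h. h *\<^sub>R v)) (at 0)"
      by (auto intro!: derivative_eq_intros)
    from has_derivative_compose[OF this, of \<phi>] D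
    have 1: "((\<lambda>h. \<phi> (z + h *\<^sub>R v)) has_derivative (\<lambda>h. frechet_derivative \<phi> (at z) (h *\<^sub>R v))) (at 0)"
      by simp
    have "((\<lambda>h. b (h + s z)) has_real_derivative \<beta> (s z) - \<beta> (s z - 1)) (at 0)"
      using DERIV_shift[of b _ 0 "s z"] b(2)[of "s z"] by simp
    then have "((\<lambda>h. a z * b (h + s z)) has_real_derivative a z * (\<beta> (s z) - \<beta> (s z - 1))) (at 0)"
      by (rule DERIV_cmult)
    moreover have "(\<lambda>h. a z * b (h + s z)) = (\<lambda>h. \<phi> (z + h *\<^sub>R v))"
      by (simp add: \<phi>_def a_shift s_shift add.commute)
    ultimately have "((\<lambda>h. \<phi> (z + h *\<^sub>R v)) has_derivative
        (\<lambda>h. a z * (\<beta> (s z) - \<beta> (s z - 1)) * h)) (at 0)"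
      by (simp add: has_field_derivative_def)
    from has_derivative_unique[OF 1 this]
    show ?thesis by (metis mult.right_neutral scaleR_one)
  qed
  define g where "g = (\<lambda>z. a z * \<beta> (s z))"
  have g_near: "z \<in> cball x r" if "g z \<noteq> 0" for z
    using near[of z 0] that \<beta>(2)[of "s z"] by (auto simp: g_def)
  have int_eq: "indicator \<Omega> z *\<^sub>R (kinetic_chi u z (sgn \<xi>) * frechet_derivative \<phi> (at z) v) = g z"
    for z
  proof (cases "g z = 0")
    case False
    then have "z \<in> cball x r" by (rule g_near)
    then have z: "z \<in> \<Omega>" "u z \<bullet> \<xi> > 0" using r(2) by blast+
    have "\<beta> (s z - 1) = 0"
    proof (rule ccontr)
      assume "\<beta> (s z - 1) \<noteq> 0"
      then have "dist (x + 1 *\<^sub>R v) z \<le> r"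
        using near[of z 1] \<beta>(2)[of "s z - 1"] False by (auto simp: g_def)
      then have "z \<in> cball y r" by (simp add: v_def)
      then show False using r(3) z by force
    qed
    then show ?thesis using z by (simp add: chi d\<phi> g_def)
  next
    case True
    have "u z \<bullet> \<xi> \<le> 0" if "a z \<noteq> 0" "\<beta> (s z - 1) \<noteq> 0"
    proof -
      have "dist (x + 1 *\<^sub>R v) z \<le> r"
        using near[of z 1] \<beta>(2)[of "s z - 1"] that by auto
      then have "z \<in> cball y r" by (simp add: v_def)
      then show ?thesis using r(3) by force
    qed
    then show ?thesis
      using True by (cases "a z = 0"; cases "\<beta> (s z - 1) = 0") (auto simp: chi d\<phi> g_def)
  qed
  have "(LINT z|lebesgue. g z) = 0"
    using zero unfolding set_lebesgue_integral_def int_eq .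
  moreover have "(LINT z|lebesgue. g z) \<noteq> 0"
  proof (rule lebesgue_integral_bump_nonzero[of g "cball x r" x])
    have "continuous_on UNIV s" "continuous_on UNIV a"
      using Ck_s[of 0] Ck_a[of 0] by auto
    then show "continuous_on UNIV g"
      unfolding g_def by (intro continuous_intros continuous_on_compose2[OF \<beta>(3)]) auto
    show "0 \<le> g z" for z
      using \<beta>(1) by (simp add: g_def a_def pos_ramp_nonneg)
    show "g x \<noteq> 0"
      using d \<beta>(2)[of 0] by (simp add: g_def a_def w_def s_def pos_ramp_eq_0_iff)
  qed (use g_near in auto)
  ultimately show False by simp
qed

text \<open>If the components of \<open>u x\<close> and \<open>u y\<close> orthogonal to \<open>y - x\<close> were not parallel, some \<open>\<xi>\<close>
  orthogonal to \<open>y - x\<close> would have \<open>u x \<bullet> \<xi> > 0 > u y \<bullet> \<xi>\<close>. Geometrically, the lines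
  \<open>x + \<real> u x\<close> and \<open>y + \<real> u y\<close> are coplanar.\<close>

lemma kinetic_coplanar:
  fixes u :: "'a::euclidean_space \<Rightarrow> 'a"
  assumes "open \<Omega>" "continuous_on \<Omega> u" "kinetic_formulation \<Omega> u" "closed_segment x y \<subseteq> \<Omega>"
  obtains \<alpha> \<beta> \<gamma> where "\<alpha> \<noteq> 0 \<or> \<beta> \<noteq> 0 \<or> \<gamma> \<noteq> 0" "\<alpha> *\<^sub>R u x + \<beta> *\<^sub>R u y + \<gamma> *\<^sub>R (y - x) = 0"
proof -
  define v where "v = y - x"
  define a where "a = u x - (u x \<bullet> v / (v \<bullet> v)) *\<^sub>R v"
  define b where "b = u y - (u y \<bullet> v / (v \<bullet> v)) *\<^sub>R v"
  show ?thesis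
  proof (cases "v = 0 \<or> a = 0")
    case True
    then show ?thesis
    proof
      assume "v = 0" then show ?thesis using that[of 0 0 1] by (simp add: v_def)
    next
      assume "a = 0"
      then show ?thesis using that[of 1 0 "- (u x \<bullet> v / (v \<bullet> v))"] by (simp add: a_def v_def)
    qed
  next
    case False
    then have av: "a \<bullet> v = 0" and bv: "b \<bullet> v = 0"
      by (simp_all add: a_def b_def inner_diff_left)
    have aa: "a \<bullet> a > 0" using False by simp
    define \<kappa> where "\<kappa> = (b \<bullet> a) / (a \<bullet> a)"
    define c where "c = b - \<kappa> *\<^sub>R a"
    have ca: "c \<bullet> a = 0" using aa by (simp add: c_def \<kappa>_def inner_diff_left)
    have cb: "c \<bullet> b = c \<bullet> c"
      using ca by (simp add: c_def inner_diff_right)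
    have cv: "c \<bullet> v = 0" using av bv by (simp add: c_def inner_diff_left)
    have "c = 0"
    proof (rule ccontr)
      assume "c \<noteq> 0"
      then have cc: "c \<bullet> c > 0" by simp
      \<comment> \<open>\<open>- c\<close> makes \<open>u y \<bullet> \<xi>\<close> negative, and a multiple of \<open>a\<close> too small to spoil this
        makes \<open>u x \<bullet> \<xi>\<close> positive\<close>
      define \<epsilon> where "\<epsilon> = (c \<bullet> c) / (\<bar>a \<bullet> b\<bar> + 1)"
      have \<epsilon>: "\<epsilon> > 0" using cc by (simp add: \<epsilon>_def)
      define \<xi> where "\<xi> = \<epsilon> *\<^sub>R a - c"
      have \<xi>v: "\<xi> \<bullet> v = 0" using av cv by (simp add: \<xi>_def inner_diff_left)
      have "u x \<bullet> \<xi> = a \<bullet> \<xi>" "u y \<bullet> \<xi> = b \<bullet> \<xi>"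
        using \<xi>v by (simp_all add: a_def b_def inner_diff_left inner_commute[of _ \<xi>] inner_diff_right)
      moreover have "a \<bullet> \<xi> = \<epsilon> * (a \<bullet> a)" "b \<bullet> \<xi> = \<epsilon> * (a \<bullet> b) - c \<bullet> c"
        using ca cb by (simp_all add: \<xi>_def inner_diff_right inner_commute)
      moreover have "\<epsilon> * (a \<bullet> b) < c \<bullet> c"
      proof -
        have "\<epsilon> * (a \<bullet> b) < \<epsilon> * (\<bar>a \<bullet> b\<bar> + 1)" using \<epsilon> by simp
        then show ?thesis by (simp add: \<epsilon>_def)
      qed
      ultimately have "u x \<bullet> \<xi> > 0" "u y \<bullet> \<xi> < 0" using \<epsilon> aa by auto
      then show False
        using kinetic_sign_transport[OF assms, of \<xi>] \<xi>v by (simp add: v_def inner_commute)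
    qed
    then have "b - \<kappa> *\<^sub>R a = 0" by (simp add: c_def)
    then show ?thesis
      by (intro that[of "- \<kappa>" 1 "\<kappa> * (u x \<bullet> v / (v \<bullet> v)) - u y \<bullet> v / (v \<bullet> v)"])
         (auto simp: a_def b_def v_def algebra_simps)
  qed
qed

section \<open>Pairwise coplanar lines in space are concurrent or parallel\<close>

text \<open>\<open>b + a x\<close> is a multiple of \<open>u x\<close>: for \<open>a \<noteq> 0\<close> the line \<open>x + \<real> u x\<close> passes through
  \<open>- b / a\<close>, for \<open>a = 0\<close> it has direction \<open>b\<close>. The equation is polynomial, hence a closed condition
  on \<open>x\<close> where \<open>u\<close> is continuous.\<close>

definition in_pencil :: "('a::euclidean_space \<Rightarrow> 'a) \<Rightarrow> real \<Rightarrow> 'a \<Rightarrow> 'a \<Rightarrow> bool" where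
  "in_pencil u a b x \<longleftrightarrow>
     (u x \<bullet> u x) *\<^sub>R (b + a *\<^sub>R x) = (u x \<bullet> (b + a *\<^sub>R x)) *\<^sub>R u x"

lemma scaleR_eq_scaleR_D:
  fixes x y :: "'a::real_vector"
  assumes "m \<noteq> 0" "m *\<^sub>R x = n *\<^sub>R y"
  shows "x = (n / m) *\<^sub>R y"
proof -
  have "x = (1 / m) *\<^sub>R (m *\<^sub>R x)" using assms(1) by simp
  then show ?thesis by (simp add: assms(2))
qed

lemma in_pencil_iff: "u x \<noteq> 0 \<Longrightarrow> in_pencil u a b x \<longleftrightarrow> (\<exists>s. b + a *\<^sub>R x = s *\<^sub>R u x)"
proof
  assume u: "u x \<noteq> 0" and "in_pencil u a b x"
  then have "b + a *\<^sub>R x = ((u x \<bullet> (b + a *\<^sub>R x)) / (u x \<bullet> u x)) *\<^sub>R u x"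
    by (intro scaleR_eq_scaleR_D) (simp_all add: in_pencil_def)
  then show "\<exists>s. b + a *\<^sub>R x = s *\<^sub>R u x" ..
next
  assume "\<exists>s. b + a *\<^sub>R x = s *\<^sub>R u x"
  then show "in_pencil u a b x" by (auto simp: in_pencil_def mult.commute)
qed

lemma not_in_span_singleton:
  fixes d :: "'a::euclidean_space"
  assumes "DIM('a) \<ge> 2"
  obtains w where "w \<notin> span {d}"
proof -
  have "span {d} \<noteq> UNIV"
  proof
    assume "span {d} = UNIV"
    then have "DIM('a) \<le> card {d}" using dim_le_card[of UNIV "{d}"] by simp
    then show False using assms by simp
  qed
  then show thesis using that by auto
qed

lemma isCont_zero_along_line:
  fixes F :: "'a::real_normed_vector \<Rightarrow> 'b::real_normed_vector"
  assumes "isCont F y" "open B" "y \<in> B"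
    and zero: "\<And>h. h \<noteq> 0 \<Longrightarrow> y + h *\<^sub>R e \<in> B \<Longrightarrow> F (y + h *\<^sub>R e) = 0"
  shows "F y = 0"
proof -
  have \<gamma>: "((\<lambda>h::real. y + h *\<^sub>R e) \<longlongrightarrow> y) (at 0)" by (auto intro!: tendsto_eq_intros)
  have "((\<lambda>h::real. F (y + h *\<^sub>R e)) \<longlongrightarrow> F y) (at 0)"
    by (rule isCont_tendsto_compose[OF \<open>isCont F y\<close> \<gamma>])
  moreover have "\<forall>\<^sub>F h in at 0. F (y + h *\<^sub>R e) = 0"
  proof -
    have "\<forall>\<^sub>F h in at 0. y + h *\<^sub>R e \<in> B" using \<gamma> assms(2,3) by (rule topological_tendstoD)
    moreover have "\<forall>\<^sub>F h in at 0. (h::real) \<noteq> 0" by (simp add: eventually_at_filter)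
    ultimately show ?thesis by eventually_elim (rule zero)
  qed
  ultimately have "((\<lambda>h::real. 0) \<longlongrightarrow> F y) (at 0)"
    by (rule Lim_transform_eventually)
  then show ?thesis by (simp add: tendsto_const_iff)
qed

text \<open>The lines of the pencil through \<open>p\<close> and \<open>x\<close> are distinct and span a plane \<open>p + V\<close>. The line
  through a point \<open>y\<close> outside that plane lies in the plane spanned by \<open>y\<close> and the first line and in
  the one spanned by \<open>y\<close> and the second; these two planes meet in the line of the pencil through
  \<open>y\<close>. Since the dimension is at least three, such points \<open>y\<close> are dense.\<close>

lemma in_pencil_propagates:
  fixes u :: "'a::euclidean_space \<Rightarrow> 'a"
  assumes dim: "DIM('a) \<ge> 3"
    and "open B" and cont: "continuous_on B u" and nz: "\<And>x. x \<in> B \<Longrightarrow> u x \<noteq> 0"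
    and coplanar: "\<And>x y. x \<in> B \<Longrightarrow> y \<in> B \<Longrightarrow> \<exists>\<alpha> \<beta> \<gamma>. (\<alpha> \<noteq> 0 \<or> \<beta> \<noteq> 0 \<or> \<gamma> \<noteq> 0) \<and>
                     \<alpha> *\<^sub>R u x + \<beta> *\<^sub>R u y + \<gamma> *\<^sub>R (y - x) = 0"
    and p: "p \<in> B" "in_pencil u a b p" and x: "x \<in> B" "in_pencil u a b x"
    and indep: "x - p \<notin> span {u p}" and ab: "a \<noteq> 0 \<or> b \<noteq> 0"
    and y: "y \<in> B"
  shows "in_pencil u a b y"
proof -
  define V where "V = span {u p, x - p}"
  obtain s where s: "b + a *\<^sub>R p = s *\<^sub>R u p"
    using p nz in_pencil_iff by blast
  obtain t where t: "b + a *\<^sub>R x = t *\<^sub>R u x"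
    using x nz in_pencil_iff by blast
  have rel: "a *\<^sub>R (x - p) = t *\<^sub>R u x - s *\<^sub>R u p"
    using s t by (metis add_diff_cancel_left scaleR_right_diff_distrib)
  have indep': "l = 0 \<and> m = 0" if "l *\<^sub>R u p + m *\<^sub>R (x - p) = 0" for l m
  proof -
    have "m = 0"
    proof (rule ccontr)
      assume "m \<noteq> 0"
      moreover from that have "m *\<^sub>R (x - p) = (- l) *\<^sub>R u p"
        by (simp add: add_eq_0_iff)
      ultimately have "x - p = (- l / m) *\<^sub>R u p"
        by (rule scaleR_eq_scaleR_D)
      then show False using indep by (metis span_base span_mul singletonI)
    qed
    then show ?thesis using that nz[OF \<open>p \<in> B\<close>] by simp
  qed
  have "t \<noteq> 0"
  proof
    assume "t = 0"
    then have "s *\<^sub>R u p + a *\<^sub>R (x - p) = 0" using rel by simp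
    then have "s = 0" "a = 0" using indep' by blast+
    then show False using s ab by simp
  qed
  have upV: "u p \<in> V" and xpV: "x - p \<in> V"
    by (auto simp: V_def intro: span_base)
  have uxV: "u x \<in> V"
  proof -
    have "t *\<^sub>R u x = a *\<^sub>R (x - p) + s *\<^sub>R u p" using rel by simp
    then have "u x = (1 / t) *\<^sub>R (a *\<^sub>R (x - p) + s *\<^sub>R u p)"
      using \<open>t \<noteq> 0\<close> by (metis divide_self_if scaleR_one scaleR_scaleR times_divide_eq_left mult_1)
    moreover have "\<dots> \<in> V"
      using upV xpV by (auto simp: V_def intro!: span_mul span_add)
    ultimately show ?thesis by simp
  qed
  \<comment> \<open>\<open>u z\<close> is expressed in the planes through \<open>z\<close> and either line; as \<open>u p\<close>, \<open>u x\<close> and \<open>x - p\<close> have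
    rank two, comparing the two expressions leaves only multiples of the relation \<open>rel\<close>\<close>
  have outside: "in_pencil u a b z" if z: "z \<in> B" "z - p \<notin> V" for z
  proof -
    have combination: "\<exists>A C. u z = A *\<^sub>R u q + C *\<^sub>R (z - q)"
      if q: "q \<in> B" "u q \<in> V" "z - q \<notin> V" for q
    proof -
      obtain \<alpha> \<beta> \<gamma> where c: "\<alpha> \<noteq> 0 \<or> \<beta> \<noteq> 0 \<or> \<gamma> \<noteq> 0"
        "\<alpha> *\<^sub>R u q + \<beta> *\<^sub>R u z + \<gamma> *\<^sub>R (z - q) = 0"
        using coplanar[OF \<open>q \<in> B\<close> \<open>z \<in> B\<close>] by blast
      have "\<beta> \<noteq> 0"
      proof
        assume "\<beta> = 0"
        then have *: "\<gamma> *\<^sub>R (z - q) = (- \<alpha>) *\<^sub>R u q" using c(2) by (simp add: add_eq_0_iff)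
        have "\<gamma> = 0"
        proof (rule ccontr)
          assume "\<gamma> \<noteq> 0"
          then have "z - q = (- \<alpha> / \<gamma>) *\<^sub>R u q"
            using * by (rule scaleR_eq_scaleR_D)
          then show False using q V_def span_mul by metis
        qed
        then show False using c \<open>\<beta> = 0\<close> nz[OF \<open>q \<in> B\<close>] by simp
      qed
      then have "\<beta> *\<^sub>R u z = \<beta> *\<^sub>R ((- \<alpha> / \<beta>) *\<^sub>R u q + (- \<gamma> / \<beta>) *\<^sub>R (z - q))"
        using c(2) by (simp add: algebra_simps add_eq_0_iff)
      then have "u z = (- \<alpha> / \<beta>) *\<^sub>R u q + (- \<gamma> / \<beta>) *\<^sub>R (z - q)"
        using \<open>\<beta> \<noteq> 0\<close> by (simp only: scaleR_cancel_left simp_thms)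
      then show ?thesis by blast
    qed
    have "z - x \<notin> V"
      using z(2) xpV span_add[of "z - x" "{u p, x - p}" "x - p"] by (auto simp: V_def)
    then obtain A C A' C' where A: "u z = A *\<^sub>R u p + C *\<^sub>R (z - p)"
      and A': "u z = A' *\<^sub>R u x + C' *\<^sub>R (z - x)"
      using combination[OF \<open>p \<in> B\<close> upV z(2)] combination[OF \<open>x \<in> B\<close> uxV] by blast
    have diff: "(C - C') *\<^sub>R (z - p) = A' *\<^sub>R u x - A *\<^sub>R u p - C' *\<^sub>R (x - p)"
    proof -
      have "A *\<^sub>R u p + C *\<^sub>R (z - p) = A' *\<^sub>R u x + C' *\<^sub>R (z - x)"
        using A A' by simp
      then show ?thesis by (simp add: algebra_simps)
    qed
    have "C = C'"
    proof (rule ccontr)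
      assume "C \<noteq> C'"
      have "(C - C') *\<^sub>R (z - p) \<in> V"
        unfolding diff using upV uxV xpV by (auto simp: V_def intro!: span_mul span_diff)
      then have "(1 / (C - C')) *\<^sub>R ((C - C') *\<^sub>R (z - p)) \<in> V"
        unfolding V_def by (rule span_mul)
      then show False using \<open>C \<noteq> C'\<close> z(2) by simp
    qed
    then have rel2: "C *\<^sub>R (x - p) = A' *\<^sub>R u x - A *\<^sub>R u p" using diff by simp
    define \<kappa> where "\<kappa> = A' / t"
    have "(A - \<kappa> * s) *\<^sub>R u p + (C - \<kappa> * a) *\<^sub>R (x - p)
        = (A *\<^sub>R u p + C *\<^sub>R (x - p)) - \<kappa> *\<^sub>R (s *\<^sub>R u p + a *\<^sub>R (x - p))"
      by (simp add: algebra_simps)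
    also have "\<dots> = A' *\<^sub>R u x - (\<kappa> * t) *\<^sub>R u x"
      by (simp add: rel rel2)
    also have "\<dots> = 0" using \<open>t \<noteq> 0\<close> by (simp add: \<kappa>_def)
    finally have "A = \<kappa> * s" "C = \<kappa> * a" using indep'[of "A - \<kappa> * s" "C - \<kappa> * a"] by simp_all
    then have "u z = \<kappa> *\<^sub>R (s *\<^sub>R u p + a *\<^sub>R (z - p))"
      using A by (simp add: scaleR_add_right)
    also have "\<dots> = \<kappa> *\<^sub>R (b + a *\<^sub>R z)"
      by (simp flip: s add: algebra_simps)
    finally have uz: "u z = \<kappa> *\<^sub>R (b + a *\<^sub>R z)" .
    then have "\<kappa> \<noteq> 0" using nz[OF z(1)] by auto
    then have "b + a *\<^sub>R z = (1 / \<kappa>) *\<^sub>R u z" by (simp add: uz)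
    then show ?thesis using in_pencil_iff[of u z] nz[OF z(1)] by blast
  qed
  show ?thesis
  proof (cases "y - p \<in> V")
    case True
    have "V \<noteq> UNIV"
    proof
      assume "V = UNIV"
      then have "DIM('a) \<le> card {u p, x - p}"
        using dim_le_card[of UNIV "{u p, x - p}"] by (simp add: V_def)
      also have "\<dots> \<le> 2" by (simp add: card_insert_if)
      finally show False using dim by simp
    qed
    then obtain e where "e \<notin> V" by auto
    have off: "(y + h *\<^sub>R e) - p \<notin> V" if "h \<noteq> 0" for h
    proof
      assume "(y + h *\<^sub>R e) - p \<in> V"
      then have "((y + h *\<^sub>R e) - p) - (y - p) \<in> V"
        using True unfolding V_def by (rule span_diff)
      then have "h *\<^sub>R e \<in> V" by simp
      then have "(1 / h) *\<^sub>R (h *\<^sub>R e) \<in> V" unfolding V_def by (rule span_mul)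
      then show False using that \<open>e \<notin> V\<close> by simp
    qed
    define F where "F = (\<lambda>z. (u z \<bullet> u z) *\<^sub>R (b + a *\<^sub>R z) - (u z \<bullet> (b + a *\<^sub>R z)) *\<^sub>R u z)"
    have "isCont u y" using cont \<open>open B\<close> y continuous_on_eq_continuous_at by blast
    then have "isCont F y" unfolding F_def by (intro continuous_intros)
    then have "F y = 0"
      using \<open>open B\<close> y outside off by (rule_tac isCont_zero_along_line[where B = B and e = e])
        (auto simp: F_def in_pencil_def)
    then show ?thesis by (simp add: F_def in_pencil_def)
  qed (use outside y in blast)
qed

text \<open>The coefficients of a linear relation between \<open>u p\<close>, \<open>u x\<close> and \<open>x - p\<close> are those of a pencil
  containing both lines.\<close>

lemma pencil_exists:
  fixes u :: "'a::euclidean_space \<Rightarrow> 'a"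
  assumes nz: "u p \<noteq> 0" "u x \<noteq> 0"
    and coplanar: "\<alpha> \<noteq> 0 \<or> \<beta> \<noteq> 0 \<or> \<gamma> \<noteq> 0" "\<alpha> *\<^sub>R u p + \<beta> *\<^sub>R u x + \<gamma> *\<^sub>R (x - p) = 0"
  obtains a b where "a \<noteq> 0 \<or> b \<noteq> 0" "in_pencil u a b p" "in_pencil u a b x"
proof (rule that[of \<gamma> "\<alpha> *\<^sub>R u p - \<gamma> *\<^sub>R p"])
  have "\<alpha> *\<^sub>R u p - \<gamma> *\<^sub>R p + \<gamma> *\<^sub>R x = (- \<beta>) *\<^sub>R u x"
    using coplanar(2) by (simp add: algebra_simps add_eq_0_iff)
  then show "in_pencil u \<gamma> (\<alpha> *\<^sub>R u p - \<gamma> *\<^sub>R p) x"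
    using in_pencil_iff[of u x] nz by blast
  have "\<alpha> *\<^sub>R u p - \<gamma> *\<^sub>R p + \<gamma> *\<^sub>R p = \<alpha> *\<^sub>R u p" by simp
  then show "in_pencil u \<gamma> (\<alpha> *\<^sub>R u p - \<gamma> *\<^sub>R p) p"
    using in_pencil_iff[of u p] nz by blast
  show "\<gamma> \<noteq> 0 \<or> \<alpha> *\<^sub>R u p - \<gamma> *\<^sub>R p \<noteq> 0"
    using coplanar nz by auto
qed

text \<open>If all lines passed through \<open>p\<close>, then \<open>u (p + h w)\<close> would be parallel to \<open>w\<close> for every \<open>w\<close>,
  and by continuity so would be \<open>u p\<close>.\<close>

lemma in_pencil_centre_notin:
  fixes u :: "'a::euclidean_space \<Rightarrow> 'a"
  assumes dim: "DIM('a) \<ge> 2" and "open B" and cont: "continuous_on B u" and "u p \<noteq> 0"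
    and pencil: "\<And>x. x \<in> B \<Longrightarrow> in_pencil u a b x"
    and ab: "a \<noteq> 0 \<or> b \<noteq> 0" and p: "p \<in> B"
  shows "b + a *\<^sub>R p \<noteq> 0"
proof
  assume 0: "b + a *\<^sub>R p = 0"
  then have "a \<noteq> 0" using ab by auto
  obtain w where w: "w \<notin> span {u p}" by (rule not_in_span_singleton[OF dim])
  define F where "F = (\<lambda>z. (u z \<bullet> u z) *\<^sub>R w - (u z \<bullet> w) *\<^sub>R u z)"
  have "isCont u p" using cont \<open>open B\<close> p continuous_on_eq_continuous_at by blast
  then have "isCont F p" unfolding F_def by (intro continuous_intros)
  then have "F p = 0"
  proof (rule isCont_zero_along_line[OF _ \<open>open B\<close> p, where e = w])
    fix h :: real assume h: "h \<noteq> 0" "p + h *\<^sub>R w \<in> B"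
    have "b + a *\<^sub>R (p + h *\<^sub>R w) = (a * h) *\<^sub>R w"
      using 0 by (simp add: algebra_simps)
    then have "(a * h) *\<^sub>R F (p + h *\<^sub>R w) = 0"
      using pencil[OF h(2)] by (simp add: in_pencil_def F_def scaleR_diff_right mult_ac)
    then show "F (p + h *\<^sub>R w) = 0" using h(1) \<open>a \<noteq> 0\<close> by simp
  qed
  then have "w = ((u p \<bullet> w) / (u p \<bullet> u p)) *\<^sub>R u p"
    using \<open>u p \<noteq> 0\<close> by (intro scaleR_eq_scaleR_D) (simp_all add: F_def)
  then show False using w span_mul[OF span_base, of "u p" "{u p}"] by (metis singletonI)
qed

section \<open>Level sets of a function with gradient in a pencil\<close>

text \<open>The gradient is \<open>2 (b + a x)\<close>, so the level sets are the hypersurfaces orthogonal to the lines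
  of the pencil: spheres around \<open>- b / a\<close>, or hyperplanes orthogonal to \<open>b\<close>.\<close>

definition pencil_quad :: "real \<Rightarrow> 'a::euclidean_space \<Rightarrow> 'a \<Rightarrow> real" where
  "pencil_quad a b x = 2 * (b \<bullet> x) + a * (x \<bullet> x)"

lemma pencil_quad_has_derivative:
  "(pencil_quad a b has_derivative (\<lambda>h. (2 *\<^sub>R (b + a *\<^sub>R x)) \<bullet> h)) (at x)"
  unfolding pencil_quad_def [abs_def]
  by (auto intro!: derivative_eq_intros simp: inner_add_left inner_commute algebra_simps)

lemma pencil_quad_sphere:
  assumes "a \<noteq> 0"
  shows "pencil_quad a b x = a * (norm (x - (- (1 / a) *\<^sub>R b)))\<^sup>2 - (b \<bullet> b) / a"
proof -
  have "(norm (x - (- (1 / a) *\<^sub>R b)))\<^sup>2 = (x + (1 / a) *\<^sub>R b) \<bullet> (x + (1 / a) *\<^sub>R b)"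
    by (simp add: power2_norm_eq_inner)
  also have "\<dots> = x \<bullet> x + (2 / a) * (b \<bullet> x) + (b \<bullet> b) / (a * a)"
    by (simp add: inner_add_left inner_add_right inner_commute)
  finally show ?thesis using assms by (simp add: pencil_quad_def field_simps)
qed

text \<open>Two points of a sphere about \<open>0\<close> that lie in a ball not containing \<open>0\<close> are joined inside that
  ball by the radial projection of their chord: on the sphere, the squared distance to \<open>P\<close> is
  \<open>\<rho>\<^sup>2 + R\<^sup>2 - 2 z \<bullet> P\<close>, and \<open>z \<bullet> P > 0\<close> only grows under the outward projection.\<close>

lemma sphere_path:
  fixes P Y :: "'a::euclidean_space"
  assumes "norm (Y - P) < e" and "e \<le> norm P"
  obtains \<gamma> :: "real \<Rightarrow> 'a" where
    "\<forall>t\<in>{0..1}. \<gamma> differentiable (at t)"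
    "\<forall>t\<in>{0..1}. norm (\<gamma> t) = norm Y"
    "\<forall>t\<in>{0..1}. norm (\<gamma> t - P) < e"
    "\<gamma> 0 = Y" "\<gamma> 1 = (norm Y / norm P) *\<^sub>R P"
proof -
  have e: "e > 0" using assms(1) norm_ge_zero[of "Y - P"] by linarith
  then have P: "norm P > 0" using assms(2) by linarith
  define \<rho> Z g where "\<rho> = norm Y" and "Z = (\<rho> / norm P) *\<^sub>R P"
    and "g = (\<lambda>t::real. (1 - t) *\<^sub>R Y + t *\<^sub>R Z)"
  have dist_sq: "(norm (z - P))\<^sup>2 = (norm z)\<^sup>2 + (norm P)\<^sup>2 - 2 * (z \<bullet> P)" for z
    by (simp add: power2_norm_eq_inner inner_diff_left inner_diff_right inner_commute)
  have Zn: "norm Z = \<rho>" using P by (simp add: Z_def \<rho>_def)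
  have YP: "Y \<bullet> P > 0"
  proof -
    have "(norm (Y - P))\<^sup>2 < (norm P)\<^sup>2"
      using assms by (intro power_strict_mono) auto
    then show ?thesis using dist_sq[of Y] zero_le_power2[of "norm Y"] by linarith
  qed
  then have \<rho>: "\<rho> > 0" by (auto simp: \<rho>_def)
  have ZP: "Z \<bullet> P > 0" using P \<rho> by (simp add: Z_def)
  have gP: "g t \<bullet> P > 0" if "t \<in> {0..1}" for t
  proof (cases "t = 0")
    case True then show ?thesis using YP by (simp add: g_def)
  next
    case False
    then have "t * (Z \<bullet> P) > 0" "(1 - t) * (Y \<bullet> P) \<ge> 0" using ZP YP that by auto
    then show ?thesis by (simp add: g_def inner_add_left)
  qed
  then have g0: "g t \<noteq> 0" if "t \<in> {0..1}" for t using that by fastforce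
  have gn: "norm (g t) \<le> \<rho>" if "t \<in> {0..1}" for t
  proof -
    have "norm (g t) \<le> norm ((1 - t) *\<^sub>R Y) + norm (t *\<^sub>R Z)"
      unfolding g_def by (rule norm_triangle_ineq)
    also have "\<dots> = (1 - t) * \<rho> + t * \<rho>" using that by (simp add: Zn \<rho>_def)
    also have "\<dots> = \<rho>" by (simp add: algebra_simps)
    finally show ?thesis .
  qed
  have ZPe: "norm (Z - P) < e"
  proof -
    have "Z - P = ((\<rho> - norm P) / norm P) *\<^sub>R P"
      using P by (simp add: Z_def diff_divide_distrib scaleR_diff_left)
    then have "norm (Z - P) = \<bar>\<rho> - norm P\<bar>" using P by simp
    also have "\<dots> \<le> norm (Y - P)" unfolding \<rho>_def by (rule norm_triangle_ineq3)
    finally show ?thesis using assms(1) by linarith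
  qed
  define \<gamma> where "\<gamma> = (\<lambda>t. (\<rho> / norm (g t)) *\<^sub>R g t)"
  have \<gamma>n: "norm (\<gamma> t) = \<rho>" if "t \<in> {0..1}" for t
    using g0[OF that] \<rho> by (simp add: \<gamma>_def)
  have "\<gamma> differentiable (at t) \<and> norm (\<gamma> t) = norm Y \<and> norm (\<gamma> t - P) < e"
    if t: "t \<in> {0..1}" for t
  proof (intro conjI)
    have dg: "g differentiable (at t)" unfolding g_def by simp
    then have "(norm \<circ> g) differentiable (at t)"
      using g0[OF t] by (intro differentiable_chain_at) auto
    then show "\<gamma> differentiable (at t)"
      unfolding \<gamma>_def using dg g0[OF t]
      by (intro differentiable_scaleR differentiable_divide) (auto simp: o_def)
    show "norm (\<gamma> t) = norm Y" using \<gamma>n[OF t] by (simp add: \<rho>_def)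
    have "g t \<bullet> P \<le> (\<rho> / norm (g t)) * (g t \<bullet> P)"
    proof -
      have "1 \<le> \<rho> / norm (g t)" using gn[OF t] g0[OF t] by (simp add: le_divide_eq)
      from mult_right_mono[OF this less_imp_le[OF gP[OF t]]] show ?thesis by simp
    qed
    then have "(norm (\<gamma> t - P))\<^sup>2 \<le> \<rho>\<^sup>2 + (norm P)\<^sup>2 - 2 * (g t \<bullet> P)"
      unfolding dist_sq \<gamma>n[OF t] by (simp add: \<gamma>_def)
    also have "\<dots> = (1 - t) * (norm (Y - P))\<^sup>2 + t * (norm (Z - P))\<^sup>2"
      unfolding dist_sq Zn \<rho>_def[symmetric] by (simp add: g_def inner_add_left algebra_simps)
    also have "\<dots> < e\<^sup>2"
    proof -
      have "(norm (Y - P))\<^sup>2 < e\<^sup>2" "(norm (Z - P))\<^sup>2 < e\<^sup>2"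
        using assms(1) ZPe by (auto intro!: power_strict_mono)
      then show ?thesis
        using t convex_bound_lt[of _ "e\<^sup>2" _ "1 - t" t] by simp
    qed
    finally show "norm (\<gamma> t - P) < e" using e by (simp add: power_less_imp_less_base)
  qed
  moreover have "\<gamma> 0 = Y" using \<rho> by (simp add: \<gamma>_def g_def \<rho>_def)
  moreover have "\<gamma> 1 = (norm Y / norm P) *\<^sub>R P" using \<rho> by (simp add: \<gamma>_def g_def Zn) (simp add: Z_def \<rho>_def)
  ultimately show ?thesis using that by blast
qed

text \<open>The end point of the curve is the point where the level set of \<open>y\<close> meets the line of the
  pencil through \<open>p\<close>.\<close>

lemma pencil_quad_path:
  fixes p y b :: "'a::euclidean_space"
  assumes y: "y \<in> ball p e" and nz: "\<And>x. x \<in> ball p e \<Longrightarrow> b + a *\<^sub>R x \<noteq> 0"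
  obtains \<gamma> :: "real \<Rightarrow> 'a" and \<tau> where
    "\<forall>t\<in>{0..1}. \<gamma> differentiable (at t)"
    "\<forall>t\<in>{0..1}. \<gamma> t \<in> ball p e"
    "\<forall>t\<in>{0..1}. pencil_quad a b (\<gamma> t) = pencil_quad a b y"
    "\<gamma> 0 = y" "\<gamma> 1 = p + \<tau> *\<^sub>R (b + a *\<^sub>R p)"
proof (cases "a = 0")
  case True
  have "b \<noteq> 0" using nz[OF y] True by simp
  then have bb: "b \<bullet> b > 0" by simp
  define \<tau> z where "\<tau> = b \<bullet> (y - p) / (b \<bullet> b)" and "z = p + \<tau> *\<^sub>R b"
  have bz: "b \<bullet> z = b \<bullet> y" using bb by (simp add: z_def \<tau>_def inner_add_right inner_diff_right)
  have "norm (z - p) \<le> norm (y - p)"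
  proof -
    have "norm (z - p) = \<bar>b \<bullet> (y - p)\<bar> / norm b"
      using bb by (simp add: z_def \<tau>_def power2_norm_eq_inner[symmetric] power2_eq_square)
    also have "\<dots> \<le> norm (y - p)"
      using \<open>b \<noteq> 0\<close> Cauchy_Schwarz_ineq2[of b "y - p"] by (simp add: divide_le_eq mult.commute)
    finally show ?thesis .
  qed
  then have z: "z \<in> ball p e" using y by (simp add: dist_norm norm_minus_commute)
  show ?thesis
  proof (rule that[of "\<lambda>t. (1 - t) *\<^sub>R y + t *\<^sub>R z" \<tau>]; (rule ballI)?)
    fix t :: real assume t: "t \<in> {0..1}"
    show "(\<lambda>t. (1 - t) *\<^sub>R y + t *\<^sub>R z) differentiable (at t)" by simp
    show "(1 - t) *\<^sub>R y + t *\<^sub>R z \<in> ball p e"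
      using convexD_alt[OF convex_ball y z, of t] t by simp
    show "pencil_quad a b ((1 - t) *\<^sub>R y + t *\<^sub>R z) = pencil_quad a b y"
      using bz True by (simp add: pencil_quad_def inner_add_right algebra_simps)
  qed (use True in \<open>auto simp: z_def\<close>)
next
  case False
  define c where "c = - (1 / a) *\<^sub>R b"
  have bc: "b = - (a *\<^sub>R c)" using False by (simp add: c_def)
  have "c \<notin> ball p e" using nz[of c] bc by auto
  then have far: "e \<le> norm (p - c)" by (simp add: dist_norm)
  have close: "norm ((y - c) - (p - c)) < e" using y by (simp add: dist_norm norm_minus_commute)
  obtain g :: "real \<Rightarrow> 'a" where g: "\<forall>t\<in>{0..1}. g differentiable (at t)"
    "\<forall>t\<in>{0..1}. norm (g t) = norm (y - c)"
    "\<forall>t\<in>{0..1}. norm (g t - (p - c)) < e"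
    "g 0 = y - c" "g 1 = (norm (y - c) / norm (p - c)) *\<^sub>R (p - c)"
    using sphere_path[OF close far] by blast
  define \<kappa> where "\<kappa> = norm (y - c) / norm (p - c)"
  show ?thesis
  proof (rule that[of "\<lambda>t. c + g t" "(\<kappa> - 1) / a"]; (rule ballI)?)
    fix t :: real assume t: "t \<in> {0..1}"
    show "(\<lambda>t. c + g t) differentiable (at t)" using bspec[OF g(1) t] by simp
    show "c + g t \<in> ball p e"
      using bspec[OF g(3) t] by (simp add: dist_norm norm_minus_commute algebra_simps)
    show "pencil_quad a b (c + g t) = pencil_quad a b y"
      unfolding pencil_quad_sphere[OF False] c_def[symmetric] using bspec[OF g(2) t] by simp
  next
    have "((\<kappa> - 1) / a) *\<^sub>R (b + a *\<^sub>R p) = (\<kappa> - 1) *\<^sub>R (p - c)"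
      using False by (simp add: bc scaleR_diff_right)
    then show "c + g 1 = p + ((\<kappa> - 1) / a) *\<^sub>R (b + a *\<^sub>R p)"
      by (simp add: g(5) \<kappa>_def[symmetric] algebra_simps)
  qed (use g in simp)
qed

text \<open>Along a curve in a level set of \<open>pencil_quad\<close> the gradient of \<open>f\<close> is orthogonal to the
  velocity, so \<open>f\<close> is constant; along the line of the pencil through \<open>p\<close> the derivative of \<open>f\<close> has
  no zero, so \<open>f\<close> takes each value there at most once.\<close>

lemma pencil_gradient_foot:
  fixes f :: "'a::euclidean_space \<Rightarrow> real" and \<gamma> :: "real \<Rightarrow> 'a"
  assumes der: "\<And>x. x \<in> ball p e \<Longrightarrow> (f has_derivative (\<lambda>h. G x \<bullet> h)) (at x)"
    and pencil: "\<And>x. x \<in> ball p e \<Longrightarrow> \<exists>s. b + a *\<^sub>R x = s *\<^sub>R G x"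
    and nz: "\<And>x. x \<in> ball p e \<Longrightarrow> b + a *\<^sub>R x \<noteq> 0"
    and \<gamma>: "\<And>t. t \<in> {0..1} \<Longrightarrow> \<gamma> differentiable (at t)"
    "\<And>t. t \<in> {0..1} \<Longrightarrow> \<gamma> t \<in> ball p e"
    "\<And>t. t \<in> {0..1} \<Longrightarrow> pencil_quad a b (\<gamma> t) = k"
    and foot: "\<gamma> 1 = p + \<tau> *\<^sub>R (b + a *\<^sub>R p)" and e: "e > 0"
  shows "\<And>t. t \<in> {0..1} \<Longrightarrow> f (\<gamma> t) = f (\<gamma> 1)" and "f (\<gamma> 1) = f p \<longleftrightarrow> \<tau> = 0"
proof -
  have orth: "G x \<bullet> h = 0 \<longleftrightarrow> (b + a *\<^sub>R x) \<bullet> h = 0" if "x \<in> ball p e" for x h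
    using pencil[OF that] nz[OF that] by auto
  have along: "((\<lambda>t. f (\<gamma> t)) has_derivative (\<lambda>h. G (\<gamma> t) \<bullet> frechet_derivative \<gamma> (at t) h)) (at t)"
    if "t \<in> {0..1}" for t
    using has_derivative_compose[OF _ der] \<gamma>(1,2)[OF that] frechet_derivative_works by blast
  have zero: "((\<lambda>t. f (\<gamma> t)) has_real_derivative 0) (at t)" if t: "0 < t" "t < 1" for t
  proof -
    have t': "t \<in> {0..1}" using t by simp
    define L where "L = frechet_derivative \<gamma> (at t)"
    have L: "(\<gamma> has_derivative L) (at t)"
      using \<gamma>(1)[OF t'] by (simp add: L_def frechet_derivative_works)
    have "((\<lambda>t. pencil_quad a b (\<gamma> t)) has_derivative (\<lambda>h. (2 *\<^sub>R (b + a *\<^sub>R \<gamma> t)) \<bullet> L h)) (at t)"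
      by (rule has_derivative_compose[OF L pencil_quad_has_derivative])
    moreover have "((\<lambda>t. pencil_quad a b (\<gamma> t)) has_derivative (\<lambda>h. 0)) (at t)"
      by (rule has_derivative_transform_within_open[OF has_derivative_const[of k], where s = "{0<..<1}"])
         (use t \<gamma>(3) in auto)
    ultimately have "(\<lambda>h. (2 *\<^sub>R (b + a *\<^sub>R \<gamma> t)) \<bullet> L h) = (\<lambda>h. 0)"
      by (rule has_derivative_unique)
    then have "(b + a *\<^sub>R \<gamma> t) \<bullet> L h = 0" for h
      by (drule_tac fun_cong[of _ _ h]) simp
    then have "G (\<gamma> t) \<bullet> L h = 0" for h
      using orth[OF \<gamma>(2)[OF t']] by simp
    then show ?thesis
      using along[OF t'] by (simp add: has_field_derivative_def L_def[symmetric] lambda_zero)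
  qed
  have cont: "continuous_on {0..1} (\<lambda>t. f (\<gamma> t))"
    using has_derivative_continuous[OF along] by (intro continuous_at_imp_continuous_on) simp
  show "f (\<gamma> t) = f (\<gamma> 1)" if "t \<in> {0..1}" for t
  proof (cases "t = 1")
    case False
    then show ?thesis
      using DERIV_isconst_end[of t 1 "\<lambda>t. f (\<gamma> t)"] that zero continuous_on_subset[OF cont, of "{t..1}"]
      by auto
  qed simp
  define w where "w = b + a *\<^sub>R p"
  have p: "p \<in> ball p e" using e by simp
  have "w \<noteq> 0" using nz[OF p] by (simp add: w_def)
  have one: "p + \<tau> *\<^sub>R w \<in> ball p e" using \<gamma>(2)[of 1] foot by (simp add: w_def)
  have inner: "p + (h * \<tau>) *\<^sub>R w \<in> ball p e" if "0 \<le> h" "h \<le> 1" for h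
    using convexD_alt[OF convex_ball p one, of h] that by (simp add: algebra_simps)
  have dline: "((\<lambda>h. f (p + (h * \<tau>) *\<^sub>R w)) has_derivative
      (\<lambda>k. G (p + (h * \<tau>) *\<^sub>R w) \<bullet> ((k * \<tau>) *\<^sub>R w))) (at h)" if "0 \<le> h" "h \<le> 1" for h
  proof -
    have "((\<lambda>h. p + (h * \<tau>) *\<^sub>R w) has_derivative (\<lambda>k. (k * \<tau>) *\<^sub>R w)) (at h)"
      by (auto intro!: derivative_eq_intros)
    from has_derivative_compose[OF this der[OF inner[OF that]]] show ?thesis .
  qed
  have "\<tau> = 0" if eq: "f (\<gamma> 1) = f p"
  proof (rule ccontr)
    assume "\<tau> \<noteq> 0"
    have "continuous_on {0..1} (\<lambda>h. f (p + (h * \<tau>) *\<^sub>R w))"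
      by (intro continuous_at_imp_continuous_on) (auto intro!: has_derivative_continuous[OF dline])
    then have "\<exists>h. 0 < h \<and> h < 1 \<and> (\<lambda>k. G (p + (h * \<tau>) *\<^sub>R w) \<bullet> ((k * \<tau>) *\<^sub>R w)) = (\<lambda>v. 0)"
      using eq foot
      by (intro Rolle_deriv[of 0 1 "\<lambda>h. f (p + (h * \<tau>) *\<^sub>R w)"] dline) (auto simp: w_def)
    then obtain h where h: "0 < h" "h < 1"
      "(\<lambda>k. G (p + (h * \<tau>) *\<^sub>R w) \<bullet> ((k * \<tau>) *\<^sub>R w)) = (\<lambda>v. 0)" by blast
    have B: "p + (h * \<tau>) *\<^sub>R w \<in> ball p e" using inner h by simp
    have "G (p + (h * \<tau>) *\<^sub>R w) \<bullet> w = 0"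
      using fun_cong[OF h(3), of "1 / \<tau>"] \<open>\<tau> \<noteq> 0\<close> by simp
    then have "(b + a *\<^sub>R (p + (h * \<tau>) *\<^sub>R w)) \<bullet> w = 0"
      using orth[OF B] by simp
    moreover have eq': "b + a *\<^sub>R (p + (h * \<tau>) *\<^sub>R w) = (1 + a * (h * \<tau>)) *\<^sub>R w"
      by (simp add: w_def algebra_simps)
    ultimately have "1 + a * (h * \<tau>) = 0" using \<open>w \<noteq> 0\<close> by simp
    then show False using nz[OF B] eq' by simp
  qed
  then show "f (\<gamma> 1) = f p \<longleftrightarrow> \<tau> = 0" using foot by auto
qed

text \<open>Both \<open>f\<close> and \<open>pencil_quad\<close> have gradients in the pencil, hence each takes its value at \<open>p\<close>
  exactly at those points whose foot on the line through \<open>p\<close> is \<open>p\<close> itself. The curves to the foot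
  provide the connected sets.\<close>

lemma pencil_gradient_level_set:
  fixes f :: "'a::euclidean_space \<Rightarrow> real"
  assumes der: "\<And>x. x \<in> ball p e \<Longrightarrow> (f has_derivative (\<lambda>h. G x \<bullet> h)) (at x)"
    and pencil: "\<And>x. x \<in> ball p e \<Longrightarrow> \<exists>s. b + a *\<^sub>R x = s *\<^sub>R G x"
    and nz: "\<And>x. x \<in> ball p e \<Longrightarrow> b + a *\<^sub>R x \<noteq> 0"
    and y: "y \<in> ball p e"
  shows "f y = f p \<longleftrightarrow> pencil_quad a b y = pencil_quad a b p"
    and "f y = f p \<Longrightarrow> \<exists>C. connected C \<and> y \<in> C \<and> p \<in> C \<and> C \<subseteq> {x \<in> ball p e. f x = f p}"
proof -
  have e: "e > 0" using y by (metis ball_eq_empty empty_iff not_le)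
  obtain \<gamma> \<tau> where \<gamma>: "\<forall>t\<in>{0..1}. \<gamma> differentiable (at (t::real))"
    "\<forall>t\<in>{0..1}. \<gamma> t \<in> ball p e"
    "\<forall>t\<in>{0..1}. pencil_quad a b (\<gamma> t) = pencil_quad a b y"
    and ends: "\<gamma> 0 = y" "\<gamma> 1 = p + \<tau> *\<^sub>R (b + a *\<^sub>R p)"
    using pencil_quad_path[OF y nz] by blast
  have f_const: "f (\<gamma> t) = f (\<gamma> 1)" if "t \<in> {0..1}" for t
    by (rule pencil_gradient_foot(1)[OF der pencil nz \<gamma>[THEN bspec] ends(2) e that])
  have f_foot: "f (\<gamma> 1) = f p \<longleftrightarrow> \<tau> = 0"
    by (rule pencil_gradient_foot(2)[OF der pencil nz \<gamma>[THEN bspec] ends(2) e])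
  have half: "\<exists>s. b + a *\<^sub>R x = s *\<^sub>R (2 *\<^sub>R (b + a *\<^sub>R x))" for x
    by (rule exI[of _ "1 / 2"]) simp
  have "pencil_quad a b (\<gamma> 1) = pencil_quad a b p \<longleftrightarrow> \<tau> = 0"
    by (rule pencil_gradient_foot(2)[OF pencil_quad_has_derivative half nz \<gamma>[THEN bspec] ends(2) e])
  moreover have "pencil_quad a b (\<gamma> 1) = pencil_quad a b y" using \<gamma>(3) by simp
  moreover have f_eq: "f y = f p \<longleftrightarrow> \<tau> = 0" using f_const[of 0] f_foot ends(1) by simp
  ultimately show "f y = f p \<longleftrightarrow> pencil_quad a b y = pencil_quad a b p" by simp
  assume "f y = f p"
  then have "\<gamma> 1 = p" using f_eq ends(2) by simp
  moreover have "continuous_on {0..1} \<gamma>"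
    using \<gamma>(1) by (auto intro!: continuous_at_imp_continuous_on differentiable_imp_continuous_within)
  then have "connected (\<gamma> ` {0..1})" by (intro connected_continuous_image) auto
  moreover have "\<gamma> ` {0..1} \<subseteq> {x \<in> ball p e. f x = f p}"
  proof (intro image_subsetI CollectI conjI)
    fix t :: real assume t: "t \<in> {0..1}"
    show "\<gamma> t \<in> ball p e" using \<gamma>(2) t by blast
    show "f (\<gamma> t) = f p" using f_const[OF t] \<open>\<gamma> 1 = p\<close> by simp
  qed
  moreover have "y \<in> \<gamma> ` {0..1}" "p \<in> \<gamma> ` {0..1}"
    using imageI[of 0 "{0..1}" \<gamma>] imageI[of 1 "{0..1}" \<gamma>] ends(1) \<open>\<gamma> 1 = p\<close> by simp_all
  ultimately show "\<exists>C. connected C \<and> y \<in> C \<and> p \<in> C \<and> C \<subseteq> {x \<in> ball p e. f x = f p}"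
    by blast
qed

section \<open>Spheres and hyperplanes are totally umbilical\<close>

lemma tangent_space_orthogonal_gradient:
  assumes H: "H \<subseteq> {x. F x = k}" and der: "(F has_derivative (\<lambda>h. G \<bullet> h)) (at p)"
    and v: "v \<in> tangent_space H p"
  shows "G \<bullet> v = 0"
proof -
  obtain \<gamma> \<epsilon> where \<gamma>: "0 < \<epsilon>" "\<gamma> ` {-\<epsilon><..<\<epsilon>} \<subseteq> H" "\<gamma> (0::real) = p"
    "(\<gamma> has_vector_derivative v) (at 0)"
    using v by (auto simp: tangent_space_def)
  have "((\<lambda>t. F (\<gamma> t)) has_derivative (\<lambda>h. G \<bullet> (h *\<^sub>R v))) (at 0)"
    by (rule has_derivative_compose[OF \<gamma>(4)[unfolded has_vector_derivative_def]])
       (use der \<gamma>(3) in simp)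
  moreover have "((\<lambda>t. F (\<gamma> t)) has_derivative (\<lambda>h. 0)) (at 0)"
  proof (rule has_derivative_transform_within_open[OF has_derivative_const[of k]])
    show "k = F (\<gamma> t)" if "t \<in> {-\<epsilon><..<\<epsilon>}" for t
      using \<gamma>(2) H that by blast
  qed (use \<gamma>(1) in auto)
  ultimately have "(\<lambda>h. G \<bullet> (h *\<^sub>R v)) = (\<lambda>h. 0)"
    by (rule has_derivative_unique)
  from fun_cong[OF this, of 1] show ?thesis by simp
qed

lemma Ck_on_pencil_quad: "Ck_on k UNIV (pencil_quad a b)"
proof -
  have "Ck_on k UNIV (\<lambda>x::'a. 2 * (b \<bullet> x) + a * ((x - 0) \<bullet> (x - 0)))"
    by (intro Ck_on_mult Ck_on_add Ck_on_const Ck_on_norm_square Ck_on_bounded_linear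
        bounded_linear_inner_right)
  then show ?thesis by (simp add: pencil_quad_def[abs_def])
qed

lemma norm_pencil_gradient:
  "(norm (b + a *\<^sub>R x))\<^sup>2 = a * pencil_quad a b x + b \<bullet> b"
  by (simp add: power2_norm_eq_inner pencil_quad_def inner_add_left inner_add_right inner_commute
      algebra_simps)

text \<open>The gradient \<open>2 (b + a x)\<close> has constant norm on a level set, so the unit normal is the affine
  map \<open>x \<mapsto> (b + a x) / m\<close>, whose differential is the multiple \<open>a / m\<close> of the identity.\<close>

lemma totally_umbilical_pencil_quad:
  fixes H :: "'a::euclidean_space set"
  assumes H: "openin (top_of_set {x. pencil_quad a b x = k}) H" and pos: "a * k + b \<bullet> b > 0"
  shows "totally_umbilical H"
proof -
  have sub: "H \<subseteq> {x. pencil_quad a b x = k}" using H openin_imp_subset by blast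
  define m where "m = sqrt (a * k + b \<bullet> b)"
  have "m > 0" using pos by (simp add: m_def)
  have norm_m: "norm (b + a *\<^sub>R x) = m" if "x \<in> H" for x
    using norm_pencil_gradient[of b a x] that sub
    by (auto simp: m_def intro!: real_sqrt_unique[symmetric])
  have "smooth_hypersurface H"
    unfolding smooth_hypersurface_def
  proof
    fix p assume p: "p \<in> H"
    obtain U where U: "open U" "H = {x. pencil_quad a b x = k} \<inter> U"
      using H by (auto simp: openin_open)
    define g where "g = (\<lambda>x. pencil_quad a b x + (- k))"
    have "Ck_on j UNIV g" for j
      unfolding g_def by (intro Ck_on_add Ck_on_pencil_quad Ck_on_const)
    then have "smooth_on U g" by (auto simp: smooth_on_def intro: Ck_on_mono)
    moreover have "frechet_derivative g (at x) \<noteq> (\<lambda>_. 0)" if "x \<in> H" for x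
    proof
      assume zero: "frechet_derivative g (at x) = (\<lambda>_. 0)"
      have "(g has_derivative (\<lambda>h. (2 *\<^sub>R (b + a *\<^sub>R x)) \<bullet> h)) (at x)"
        using has_derivative_add[OF pencil_quad_has_derivative has_derivative_const[of "- k"]]
        by (simp add: g_def)
      then have "(\<lambda>h. (2 *\<^sub>R (b + a *\<^sub>R x)) \<bullet> h) = (\<lambda>_. 0)"
        using frechet_derivative_at zero by metis
      from fun_cong[OF this, of "b + a *\<^sub>R x"] have "b + a *\<^sub>R x = 0" by simp
      then show False using norm_m[OF that] \<open>m > 0\<close> by simp
    qed
    moreover have "H \<inter> U = {x \<in> U. g x = 0}" using U(2) by (auto simp: g_def)
    ultimately show "\<exists>U (g :: 'a \<Rightarrow> real). open U \<and> p \<in> U \<and> smooth_on U g \<and>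
        H \<inter> U = {x \<in> U. g x = 0} \<and> (\<forall>x\<in>H \<inter> U. frechet_derivative g (at x) \<noteq> (\<lambda>_. 0))"
      using U p by (intro exI[of _ U] exI[of _ g]) auto
  qed
  moreover define n where "n = (\<lambda>x. (1 / m) *\<^sub>R (b + a *\<^sub>R x))"
  have "gauss_map H n"
    unfolding gauss_map_def
  proof (intro conjI ballI)
    show "continuous_on H n" unfolding n_def by (intro continuous_intros)
    show "norm (n x) = 1" if "x \<in> H" for x
      using norm_m[OF that] \<open>m > 0\<close> by (simp add: n_def)
    show "n x \<bullet> v = 0" if "x \<in> H" "v \<in> tangent_space H x" for x v
      using tangent_space_orthogonal_gradient[OF sub pencil_quad_has_derivative that(2)]
      by (simp add: n_def)
  qed
  moreover have "(n has_derivative (\<lambda>v. (a / m) *\<^sub>R v)) (at p within H)" for p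
    unfolding n_def by (auto intro!: derivative_eq_intros)
  ultimately show ?thesis
    unfolding totally_umbilical_def by blast
qed

lemma piece_of_pencil_quad:
  fixes S :: "'a::euclidean_space set"
  assumes S: "openin (top_of_set {x. pencil_quad a b x = k}) S" and pos: "a * k + b \<bullet> b > 0"
  shows "piece_of_sphere S \<or> piece_of_hyperplane S"
proof (cases "a = 0")
  case True
  have eq: "{x. pencil_quad a b x = k} = {x. b \<bullet> x = k / 2}"
    using True by (auto simp: pencil_quad_def)
  have "b \<noteq> 0" using pos True by auto
  then have "piece_of_hyperplane S" using S unfolding eq piece_of_hyperplane_def by blast
  then show ?thesis ..
next
  case False
  define c r where "c = - (1 / a) *\<^sub>R b" and "r = sqrt (a * k + b \<bullet> b) / \<bar>a\<bar>"
  have "r > 0" using pos False by (simp add: r_def)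
  have r2: "r\<^sup>2 = (a * k + b \<bullet> b) / a\<^sup>2" using pos by (simp add: r_def power_divide)
  have "pencil_quad a b x = k \<longleftrightarrow> norm (x - c) = r" for x
  proof -
    have "pencil_quad a b x = k \<longleftrightarrow> (norm (x - c))\<^sup>2 = r\<^sup>2"
      unfolding pencil_quad_sphere[OF False] c_def[symmetric] r2
      using False by (auto simp: field_simps power2_eq_square)
    then show ?thesis using \<open>r > 0\<close> by (simp add: power2_eq_iff_nonneg)
  qed
  then have "{x. pencil_quad a b x = k} = sphere c r"
    by (simp add: set_eq_iff dist_norm norm_minus_commute)
  then have "piece_of_sphere S" using S \<open>r > 0\<close> by (auto simp: piece_of_sphere_def)
  then show ?thesis ..
qed

section \<open>Level sets of the potential\<close>

lemma smooth_gradient_continuous: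
  assumes "smooth_on \<Omega> \<psi>" and grad: "\<And>x. x \<in> \<Omega> \<Longrightarrow> (\<psi> has_derivative (\<lambda>h. u x \<bullet> h)) (at x)"
  shows "continuous_on \<Omega> u"
proof -
  have "Ck_on (Suc 0) \<Omega> \<psi>" using assms(1) by (simp add: smooth_on_def)
  then have *: "continuous_on \<Omega> (\<lambda>x. frechet_derivative \<psi> (at x) v)" for v by simp
  have "frechet_derivative \<psi> (at x) v = u x \<bullet> v" if "x \<in> \<Omega>" for x v
    using frechet_derivative_at[OF grad[OF that]] by metis
  then have "continuous_on \<Omega> (\<lambda>x. u x \<bullet> v)" for v
    by (rule continuous_on_eq[OF *])
  then show ?thesis by (subst continuous_on_componentwise) blast
qed

lemma open_off_line:
  fixes d :: "'a::euclidean_space"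
  assumes "DIM('a) \<ge> 2" "open B" "x \<in> B"
  obtains z where "z \<in> B" "z - x \<notin> span {d}"
proof -
  obtain w where w: "w \<notin> span {d}" by (rule not_in_span_singleton[OF assms(1)])
  obtain e where e: "e > 0" "ball x e \<subseteq> B" using assms open_contains_ball by blast
  have "w \<noteq> 0" using w span_zero by blast
  define h where "h = e / (2 * norm w)"
  have h: "h > 0" using e \<open>w \<noteq> 0\<close> by (simp add: h_def)
  have "x + h *\<^sub>R w \<in> B"
    using e \<open>w \<noteq> 0\<close> h by (intro subsetD[OF e(2)]) (simp add: dist_norm h_def)
  moreover have "(x + h *\<^sub>R w) - x \<notin> span {d}"
  proof
    assume "(x + h *\<^sub>R w) - x \<in> span {d}"
    then have "h *\<^sub>R w \<in> span {d}" by simp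
    then have "(1 / h) *\<^sub>R (h *\<^sub>R w) \<in> span {d}" by (rule span_mul)
    then show False using h w by simp
  qed
  ultimately show thesis by (rule that)
qed

text \<open>Propagation makes membership in a given pencil open and closed along a connected set.\<close>

lemma kinetic_pencil:
  fixes u :: "'a::euclidean_space \<Rightarrow> 'a"
  assumes dim: "DIM('a) \<ge> 3" and "open \<Omega>" and cont: "continuous_on \<Omega> u"
    and kin: "kinetic_formulation \<Omega> u"
    and S: "connected S" "S \<noteq> {}" "S \<subseteq> \<Omega>" and nz: "\<And>x. x \<in> S \<Longrightarrow> u x \<noteq> 0"
  obtains a b where "a \<noteq> 0 \<or> b \<noteq> 0"
    and "\<And>p. p \<in> S \<Longrightarrow> \<exists>e>0. ball p e \<subseteq> \<Omega> \<and> (\<forall>x\<in>ball p e. u x \<noteq> 0 \<and> in_pencil u a b x)"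
proof -
  have dim2: "DIM('a) \<ge> 2" using dim by simp
  have good_ball: "\<exists>e>0. ball p e \<subseteq> {x \<in> \<Omega>. u x \<noteq> 0}" if "p \<in> S" for p
  proof -
    have "open {x \<in> \<Omega>. u x \<noteq> 0}"
      using continuous_open_preimage[OF cont \<open>open \<Omega>\<close>, of "- {0}"]
      by (simp add: vimage_def Int_def open_Compl)
    then show ?thesis using that S nz open_contains_ball by blast
  qed
  have coplanar: "\<exists>\<alpha> \<beta> \<gamma>. (\<alpha> \<noteq> 0 \<or> \<beta> \<noteq> 0 \<or> \<gamma> \<noteq> 0) \<and>
      \<alpha> *\<^sub>R u x + \<beta> *\<^sub>R u y + \<gamma> *\<^sub>R (y - x) = 0"
    if "ball p e \<subseteq> \<Omega>" "x \<in> ball p e" "y \<in> ball p e" for p e x y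
  proof -
    have "closed_segment x y \<subseteq> \<Omega>"
      using that closed_segment_subset[OF that(2,3) convex_ball] by blast
    then show ?thesis using kinetic_coplanar[OF \<open>open \<Omega>\<close> cont kin] by metis
  qed
  have propagate: "in_pencil u a b y"
    if e: "ball q e \<subseteq> {x \<in> \<Omega>. u x \<noteq> 0}" and "x \<in> ball q e" "in_pencil u a b x"
      and "z \<in> ball q e" "in_pencil u a b z" "z - x \<notin> span {u x}" "a \<noteq> 0 \<or> b \<noteq> 0"
      and "y \<in> ball q e" for q e x z y a b
  proof (rule in_pencil_propagates[OF dim, of "ball q e" u x a b z y])
    show "continuous_on (ball q e) u" using cont e by (auto intro: continuous_on_subset)
    show "\<exists>\<alpha> \<beta> \<gamma>. (\<alpha> \<noteq> 0 \<or> \<beta> \<noteq> 0 \<or> \<gamma> \<noteq> 0) \<and> \<alpha> *\<^sub>R u x + \<beta> *\<^sub>R u y + \<gamma> *\<^sub>R (y - x) = 0"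
      if "x \<in> ball q e" "y \<in> ball q e" for x y
      using coplanar[OF _ that] e by blast
  qed (use that in auto)
  obtain p where p: "p \<in> S" using S by blast
  obtain e where e: "e > 0" "ball p e \<subseteq> {x \<in> \<Omega>. u x \<noteq> 0}" using good_ball[OF p] by blast
  have pe: "p \<in> ball p e" using e by simp
  obtain z where z: "z \<in> ball p e" "z - p \<notin> span {u p}"
    by (rule open_off_line[OF dim2 open_ball pe])
  obtain \<alpha> \<beta> \<gamma> where "\<alpha> \<noteq> 0 \<or> \<beta> \<noteq> 0 \<or> \<gamma> \<noteq> 0" "\<alpha> *\<^sub>R u p + \<beta> *\<^sub>R u z + \<gamma> *\<^sub>R (z - p) = 0"
    using coplanar[OF _ pe z(1)] e(2) by blast
  then obtain a b where ab: "a \<noteq> 0 \<or> b \<noteq> 0" "in_pencil u a b p" "in_pencil u a b z"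
    using pencil_exists[of u p z \<alpha> \<beta> \<gamma>] e(2) pe z(1) by blast
  define near where
    "near = (\<lambda>q. \<exists>e>0. ball q e \<subseteq> \<Omega> \<and> (\<forall>x\<in>ball q e. u x \<noteq> 0 \<and> in_pencil u a b x))"
  have "near p"
    unfolding near_def
    using e propagate[OF e(2) pe ab(2) z(1) ab(3) z(2) ab(1)] by blast
  have "near q" if "q \<in> S" for q
  proof (rule connected_induction_simple[where P = near, OF \<open>connected S\<close> p that \<open>near p\<close>])
    fix q assume "q \<in> S"
    then obtain e where e: "e > 0" "ball q e \<subseteq> {x \<in> \<Omega>. u x \<noteq> 0}" using good_ball by blast
    have "near y" if x: "x \<in> S \<inter> ball q e" "near x" and y: "y \<in> S \<inter> ball q e" for x y
    proof -
      obtain e' where e': "e' > 0" "\<forall>z\<in>ball x e'. in_pencil u a b z"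
        using \<open>near x\<close> by (auto simp: near_def)
      have "open (ball q e \<inter> ball x e')" "x \<in> ball q e \<inter> ball x e'" using x e' by auto
      then obtain z where z: "z \<in> ball q e \<inter> ball x e'" "z - x \<notin> span {u x}"
        using open_off_line[OF dim2] by metis
      have all: "\<forall>w\<in>ball q e. in_pencil u a b w"
        using propagate[OF e(2), of x a b z] x z e' ab(1) by auto
      obtain e'' where "e'' > 0" "ball y e'' \<subseteq> ball q e"
        using y openE[OF open_ball, of y q e] by blast
      then show ?thesis unfolding near_def using all e(2) by blast
    qed
    then have "\<forall>x\<in>S \<inter> ball q e. \<forall>y\<in>S \<inter> ball q e. near x \<longrightarrow> near y" by blast
    moreover have "openin (top_of_set S) (S \<inter> ball q e)" by (rule openin_open_Int[OF open_ball])
    moreover have "q \<in> S \<inter> ball q e" using \<open>q \<in> S\<close> e(1) by simp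
    ultimately show "\<exists>T. openin (top_of_set S) T \<and> q \<in> T \<and> (\<forall>x\<in>T. \<forall>y\<in>T. near x \<longrightarrow> near y)"
      by (intro exI[of _ "S \<inter> ball q e"] conjI)
  qed
  then show thesis using that[OF ab(1)] by (simp add: near_def)
qed

text \<open>Near a point of \<open>S\<close> the level set of \<open>\<psi>\<close> is the level set of \<open>pencil_quad\<close>, and all its nearby
  points are joined to that point within it, hence belong to the same component.\<close>

lemma kinetic_potential_level_component:
  fixes \<psi> :: "'a::euclidean_space \<Rightarrow> real"
  assumes dim: "DIM('a) \<ge> 3" and "open \<Omega>" and "smooth_on \<Omega> \<psi>"
    and grad: "\<And>x. x \<in> \<Omega> \<Longrightarrow> (\<psi> has_derivative (\<lambda>h. u x \<bullet> h)) (at x)"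
    and kin: "kinetic_formulation \<Omega> u"
    and nz: "\<And>x. x \<in> \<Omega> \<Longrightarrow> \<psi> x = \<alpha> \<Longrightarrow> u x \<noteq> 0"
    and S: "S \<in> components {x \<in> \<Omega>. \<psi> x = \<alpha>}"
  obtains a b k where "a * k + b \<bullet> b > 0" "openin (top_of_set {x. pencil_quad a b x = k}) S"
proof -
  have cont: "continuous_on \<Omega> u"
    using smooth_gradient_continuous[OF \<open>smooth_on \<Omega> \<psi>\<close> grad] .
  have S': "connected S" "S \<noteq> {}" "S \<subseteq> {x \<in> \<Omega>. \<psi> x = \<alpha>}"
    using S in_components_connected in_components_nonempty in_components_subset by blast+
  then have "S \<subseteq> \<Omega>" and nzS: "\<And>x. x \<in> S \<Longrightarrow> u x \<noteq> 0" using nz by auto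
  obtain a b where ab: "a \<noteq> 0 \<or> b \<noteq> 0"
    and pencil: "\<And>p. p \<in> S \<Longrightarrow> \<exists>e>0. ball p e \<subseteq> \<Omega> \<and> (\<forall>x\<in>ball p e. u x \<noteq> 0 \<and> in_pencil u a b x)"
    using kinetic_pencil[OF dim \<open>open \<Omega>\<close> cont kin S'(1,2) \<open>S \<subseteq> \<Omega>\<close> nzS] by metis
  have centre: "b + a *\<^sub>R p \<noteq> 0" if p: "p \<in> S" for p
  proof -
    obtain e where e: "e > 0" "ball p e \<subseteq> \<Omega>" "\<forall>x\<in>ball p e. u x \<noteq> 0 \<and> in_pencil u a b x"
      using pencil[OF p] by blast
    show ?thesis
      by (rule in_pencil_centre_notin[of "ball p e" u p a b])
         (use dim e ab nzS[OF p] cont in \<open>auto intro: continuous_on_subset\<close>)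
  qed
  have level: "\<exists>e>0. \<forall>y\<in>ball p e. (\<psi> y = \<psi> p \<longleftrightarrow> pencil_quad a b y = pencil_quad a b p) \<and>
      (\<psi> y = \<psi> p \<longrightarrow> (\<exists>C. connected C \<and> y \<in> C \<and> p \<in> C \<and> C \<subseteq> {x \<in> \<Omega>. \<psi> x = \<psi> p}))"
    if p: "p \<in> S" for p
  proof -
    obtain e where e: "e > 0" "ball p e \<subseteq> \<Omega>" "\<forall>x\<in>ball p e. u x \<noteq> 0 \<and> in_pencil u a b x"
      using pencil[OF p] by blast
    have "open {x. b + a *\<^sub>R x \<noteq> 0}" by (intro open_Collect_neq continuous_intros)
    then obtain e' where e': "e' > 0" "ball p e' \<subseteq> {x. b + a *\<^sub>R x \<noteq> 0}"
      using centre[OF p] open_contains_ball by blast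
    define r where "r = min e e'"
    have r: "r > 0" "ball p r \<subseteq> ball p e" "ball p r \<subseteq> ball p e'"
      using e e' by (auto simp: r_def)
    have der: "(\<psi> has_derivative (\<lambda>h. u x \<bullet> h)) (at x)" if "x \<in> ball p r" for x
      using grad r e(2) that by blast
    have par: "\<exists>s. b + a *\<^sub>R x = s *\<^sub>R u x" if "x \<in> ball p r" for x
      using e(3) r(2) that in_pencil_iff by blast
    have ne: "b + a *\<^sub>R x \<noteq> 0" if "x \<in> ball p r" for x
      using e'(2) r(3) that by blast
    have "(\<psi> y = \<psi> p \<longleftrightarrow> pencil_quad a b y = pencil_quad a b p) \<and>
      (\<psi> y = \<psi> p \<longrightarrow> (\<exists>C. connected C \<and> y \<in> C \<and> p \<in> C \<and> C \<subseteq> {x \<in> \<Omega>. \<psi> x = \<psi> p}))"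
      if y: "y \<in> ball p r" for y
    proof (intro conjI impI)
      show "\<psi> y = \<psi> p \<longleftrightarrow> pencil_quad a b y = pencil_quad a b p" 
        by (rule pencil_gradient_level_set(1)[OF der par ne y])
      assume eq: "\<psi> y = \<psi> p"
      have "\<exists>C. connected C \<and> y \<in> C \<and> p \<in> C \<and> C \<subseteq> {x \<in> ball p r. \<psi> x = \<psi> p}"
        by (rule pencil_gradient_level_set(2)[OF der par ne y eq])
      then obtain C where "connected C" "y \<in> C" "p \<in> C" "C \<subseteq> {x \<in> ball p r. \<psi> x = \<psi> p}"
        by blast
      then show "\<exists>C. connected C \<and> y \<in> C \<and> p \<in> C \<and> C \<subseteq> {x \<in> \<Omega>. \<psi> x = \<psi> p}"
        using r(2) e(2) by blast
    qed
    then show ?thesis using r(1) by blast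
  qed
  obtain p where p: "p \<in> S" using S'(2) by blast
  define k where "k = pencil_quad a b p"
  have const: "pencil_quad a b q = k" if "q \<in> S" for q
  proof (rule connected_induction_simple[where P = "\<lambda>q. pencil_quad a b q = k", OF \<open>connected S\<close> p that])
    fix q assume q: "q \<in> S"
    obtain e where e: "e > 0" "\<forall>y\<in>ball q e. \<psi> y = \<psi> q \<longleftrightarrow> pencil_quad a b y = pencil_quad a b q"
      using level[OF q] by blast
    have "pencil_quad a b x = pencil_quad a b q" if x: "x \<in> S \<inter> ball q e" for x
    proof -
      have "\<psi> x = \<psi> q" using x q S'(3) by auto
      then show ?thesis using e(2) x by blast
    qed
    then have "\<forall>x\<in>S \<inter> ball q e. \<forall>y\<in>S \<inter> ball q e. pencil_quad a b x = k \<longrightarrow> pencil_quad a b y = k"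
      by metis
    moreover have "openin (top_of_set S) (S \<inter> ball q e)" by (rule openin_open_Int[OF open_ball])
    moreover have "q \<in> S \<inter> ball q e" using q e(1) by simp
    ultimately show "\<exists>T. openin (top_of_set S) T \<and> q \<in> T \<and>
        (\<forall>x\<in>T. \<forall>y\<in>T. pencil_quad a b x = k \<longrightarrow> pencil_quad a b y = k)"
      by (intro exI[of _ "S \<inter> ball q e"] conjI)
  qed (simp add: k_def)
  show thesis
  proof (rule that)
    have "a * k + b \<bullet> b = (norm (b + a *\<^sub>R p))\<^sup>2"
      unfolding norm_pencil_gradient k_def ..
    then show "a * k + b \<bullet> b > 0" using centre[OF p] by simp
    show "openin (top_of_set {x. pencil_quad a b x = k}) S"
      unfolding openin_euclidean_subtopology_iff
    proof (intro conjI ballI)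
      show "S \<subseteq> {x. pencil_quad a b x = k}" using const by blast
      fix q assume q: "q \<in> S"
      obtain e where e: "e > 0" "\<forall>y\<in>ball q e. (\<psi> y = \<psi> q \<longleftrightarrow> pencil_quad a b y = pencil_quad a b q) \<and>
          (\<psi> y = \<psi> q \<longrightarrow> (\<exists>C. connected C \<and> y \<in> C \<and> q \<in> C \<and> C \<subseteq> {x \<in> \<Omega>. \<psi> x = \<psi> q}))"
        using level[OF q] by blast
      have "y \<in> S" if y: "pencil_quad a b y = k" "dist y q < e" for y
      proof -
        have "y \<in> ball q e" using y by (simp add: dist_commute)
        moreover have "pencil_quad a b y = pencil_quad a b q" using y const[OF q] by simp
        ultimately obtain C where C: "connected C" "y \<in> C" "q \<in> C" "C \<subseteq> {x \<in> \<Omega>. \<psi> x = \<psi> q}"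
          using e(2) by blast
        have "C \<subseteq> S"
          using components_maximal[OF S C(1)] C q S'(3) by auto
        then show ?thesis using C(2) by blast
      qed
      then show "\<exists>e>0. \<forall>x'\<in>{x. pencil_quad a b x = k}. dist x' q < e \<longrightarrow> x' \<in> S"
        using e(1) by blast
    qed
  qed
qed

theorem theorem7:
  fixes \<Omega> :: "(real ^ 'n) set"
    and \<psi> :: "real ^ 'n \<Rightarrow> real"
    and u :: "real ^ 'n \<Rightarrow> real ^ 'n"
    and \<alpha> :: real
    and S :: "(real ^ 'n) set"
  assumes "CARD('n) \<ge> 3"
    and "open \<Omega>"
    and "smooth_on \<Omega> \<psi>"
    and "\<forall>x\<in>\<Omega>. GDERIV \<psi> x :> u x"
    and "kinetic_formulation \<Omega> u"
    and "\<forall>x\<in>{x \<in> \<Omega>. \<psi> x = \<alpha>}. norm (u x) \<noteq> 0"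
    and "S \<in> components {x \<in> \<Omega>. \<psi> x = \<alpha>}"
  shows "locally totally_umbilical S \<and> (piece_of_sphere S \<or> piece_of_hyperplane S)"
proof -
  have "DIM(real ^ 'n) \<ge> 3" using assms(1) by simp
  moreover have "(\<psi> has_derivative (\<lambda>h. u x \<bullet> h)) (at x)" if "x \<in> \<Omega>" for x
    using assms(4) that by (simp add: gderiv_def inner_commute)
  moreover have "u x \<noteq> 0" if "x \<in> \<Omega>" "\<psi> x = \<alpha>" for x
    using assms(6) that by auto
  ultimately obtain a b k where pos: "a * k + b \<bullet> b > 0"
    and S: "openin (top_of_set {x. pencil_quad a b x = k}) S"
    using kinetic_potential_level_component[OF _ assms(2,3) _ assms(5) _ assms(7)] by blast
  have "locally totally_umbilical S"
    unfolding locally_def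
    using totally_umbilical_pencil_quad[OF openin_trans[OF _ S] pos] by blast
  then show ?thesis using piece_of_pencil_quad[OF S pos] by blast
qed

end
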